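(* Let $G$ be a (finite) graph without isolated vertices, with at least one edge. There exists a constant $C_G>0$ depending only on $G$ such that for all $p\in(0,1)$ and all integers $n\ge v_G$, $$d_K(\tilde N_G,\mathcal N)\le C_G\left((1-p)\min_{\substack{H\subset G\\ e_H\ge1}}\big\{n^{v_H}p^{e_H}\big\}\right)^{-1/2}.$$
   Context: Graphs are finite and simple. For a graph $H$, $v_H$ and $e_H$ denote its numbers of vertices and edges; $H\subset G$ means that $H$ is a subgraph of $G$. $\mathbb G_n(p)$ is the Erdős–Rényi random graph obtained by independently retaining each edge of the complete graph $K_n$ on $n$ vertices with probability $p$. $N_G$ is the number of (not necessarily induced) subgraphs of $\mathbb G_n(p)$ isomorphic to $G$, and $$\tilde N_G=\frac{N_G-\mathbb E[N_G]}{\sqrt{\mathrm{Var}[N_G]}}.$$ $d_K(F,\mathcal N)=\sup_{x\in\mathbb R}|P(F\le x)-P(\mathcal N\le x)|$ is the Kolmogorov distance, where $\mathcal N$ is a standard normal random variable. *)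

theory Defs
  imports "HOL-Probability.Probability"
begin

section \<open>Finite simple graphs\<close>

text \<open>A graph is a pair of a vertex set and a set of undirected edges, each edge being a
  two-element set of vertices.\<close>

type_synonym 'a ugraph = "'a set \<times> 'a set set"

abbreviation verts :: "'a ugraph \<Rightarrow> 'a set" where "verts \<equiv> fst"
abbreviation edges :: "'a ugraph \<Rightarrow> 'a set set" where "edges \<equiv> snd"

definition complete_edges :: "'a set \<Rightarrow> 'a set set" where
  "complete_edges V = {e. e \<subseteq> V \<and> card e = 2}"

definition finite_simple_graph :: "'a ugraph \<Rightarrow> bool" where
  "finite_simple_graph G \<longleftrightarrow> finite (verts G) \<and> edges G \<subseteq> complete_edges (verts G)"

definition num_verts :: "'a ugraph \<Rightarrow> nat" where "num_verts G = card (verts G)"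
definition num_edges :: "'a ugraph \<Rightarrow> nat" where "num_edges G = card (edges G)"

definition isolated_vertex :: "'a ugraph \<Rightarrow> 'a \<Rightarrow> bool" where
  "isolated_vertex G v \<longleftrightarrow> v \<in> verts G \<and> (\<forall>e\<in>edges G. v \<notin> e)"

definition subgraph :: "'a ugraph \<Rightarrow> 'a ugraph \<Rightarrow> bool" where
  "subgraph H G \<longleftrightarrow> finite_simple_graph H \<and> verts H \<subseteq> verts G \<and> edges H \<subseteq> edges G"

definition isomorphic :: "'a ugraph \<Rightarrow> 'b ugraph \<Rightarrow> bool" where
  "isomorphic G H \<longleftrightarrow> (\<exists>f. bij_betw f (verts G) (verts H) \<and>
     (\<forall>u\<in>verts G. \<forall>v\<in>verts G. {u, v} \<in> edges G \<longleftrightarrow> {f u, f v} \<in> edges H))"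


section \<open>Subgraph counts in the Erdos-Renyi random graph\<close>

definition random_graph :: "nat \<Rightarrow> real \<Rightarrow> nat ugraph pmf" where
  "random_graph n p =
     map_pmf (\<lambda>retained. ({..<n}, {e \<in> complete_edges {..<n}. retained e}))
       (Pi_pmf (complete_edges {..<n}) False (\<lambda>_. bernoulli_pmf p))"

text \<open>The subgraphs counted are not necessarily induced.\<close>

definition subgraph_count :: "'a ugraph \<Rightarrow> 'b ugraph \<Rightarrow> real" where
  "subgraph_count G K = real (card {H. subgraph H K \<and> isomorphic H G})"

definition normalized_subgraph_count ::
    "'a ugraph \<Rightarrow> nat \<Rightarrow> real \<Rightarrow> nat ugraph \<Rightarrow> real" where
  "normalized_subgraph_count G n p K =
     (subgraph_count G K - measure_pmf.expectation (random_graph n p) (subgraph_count G)) /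
     sqrt (measure_pmf.variance (random_graph n p) (subgraph_count G))"


section \<open>Kolmogorov distance\<close>

text \<open>The distance is taken between the laws of the random variables; \<^term>\<open>cdf M x\<close> is
  the mass that \<^term>\<open>M\<close> gives to \<^term>\<open>{..x}\<close>.\<close>

definition kolmogorov_dist :: "real measure \<Rightarrow> real measure \<Rightarrow> real" where
  "kolmogorov_dist M N = (SUP x. \<bar>cdf M x - cdf N x\<bar>)"

end

theory Submission
  imports Defs
begin

text \<open>
  Number the potential edges by \<open>k\<close>, let \<open>X k\<close> be the independent edge indicators, \<open>q = 1 - p\<close>,
  and let \<open>D k F\<close> be the discrete derivative of \<open>F\<close> in the coordinate \<open>k\<close>. Expanding each product
  of indicators telescopically writes the normalised count as \<open>W = (\<Sum>k. (X k - p) * u k)\<close>, where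
  \<open>u k \<ge> 0\<close> does not depend on \<open>X k\<close>. Integration by parts gives
  \<open>E (W * f W) = p * q * (\<Sum>k. E (u k * D k (f W)))\<close>. For the Stein solution \<open>f\<close>, the derivative \<open>f'\<close>
  is the sum of an increasing and a decreasing bounded function; as \<open>u k\<close> and \<open>D k W\<close> are
  nonnegative, the error made in replacing \<open>D k (f W)\<close> by \<open>D k W * f' W\<close> is dominated by a discrete
  derivative, and integrating by parts backwards avoids any loss from the discontinuity of \<open>f'\<close>:
  the distance of \<open>W\<close> to the normal law is at most
  \<open>2 * E \<bar>1 - p * q * (\<Sum>k. u k * D k W)\<bar> + 2 * E \<bar>\<Sum>k. (X k - p) * u k * D k W\<bar>\<close>.

  The second moments of both terms reduce to the sum of \<open>p ^ card U\<close>, \<open>U\<close> the union of the edge sets,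
  over quadruples of copies that can be attached to each other one by one along common edges.
  Attaching a copy along a subgraph \<open>H\<close> contributes a factor of order
  \<open>n ^ (v G - v H) * p ^ (e G - e H) \<le> n ^ v G * p ^ e G / m\<close>, where \<open>m\<close> is the minimum in the theorem.
  Conversely, the pairs of copies sharing the minimising \<open>H\<close> make the variance at least a constant
  times \<open>q * (n ^ v G * p ^ e G)\<^sup>2 / m\<close>.
\<close>

section \<open>Stein's equation for the normal distribution\<close>

abbreviation std_normal_cdf :: "real \<Rightarrow> real" ("\<Phi>") where
  "\<Phi> \<equiv> cdf std_normal_distribution"

lemma std_normal_cdf_bounds: "0 \<le> \<Phi> x" "\<Phi> x \<le> 1"
proof -
  interpret real_distribution std_normal_distribution by (rule real_dist_normal_dist)
  show "0 \<le> \<Phi> x" "\<Phi> x \<le> 1" by (auto simp: cdf_nonneg cdf_bounded_prob)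
qed

lemma std_normal_cdf_mono: "x \<le> y \<Longrightarrow> \<Phi> x \<le> \<Phi> y"
proof -
  interpret real_distribution std_normal_distribution by (rule real_dist_normal_dist)
  show "x \<le> y \<Longrightarrow> \<Phi> x \<le> \<Phi> y" by (rule cdf_nondecreasing)
qed

lemma std_normal_cdf_limits: "(\<Phi> \<longlongrightarrow> 1) at_top" "(\<Phi> \<longlongrightarrow> 0) at_bot"
proof -
  interpret real_distribution std_normal_distribution by (rule real_dist_normal_dist)
  show "(\<Phi> \<longlongrightarrow> 1) at_top" "(\<Phi> \<longlongrightarrow> 0) at_bot"
    by (auto simp: cdf_lim_at_top_prob cdf_lim_at_bot)
qed

lemma std_normal_density_deriv:
  "(std_normal_density has_real_derivative - x * std_normal_density x) (at x)"
proof -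
  have "((\<lambda>x. c * exp (- x\<^sup>2 / 2)) has_real_derivative - x * (c * exp (- x\<^sup>2 / 2))) (at x)" for c
    by (auto intro!: derivative_eq_intros simp: power2_eq_square)
  then show ?thesis unfolding std_normal_density_def .
qed

lemma std_normal_cdf_eq_integral:
  assumes "a \<le> x"
  shows "\<Phi> x = \<Phi> a + integral {a..x} std_normal_density"
proof -
  interpret real_distribution std_normal_distribution by (rule real_dist_normal_dist)
  have "\<Phi> x - \<Phi> a = measure std_normal_distribution {a<..x}"
  proof (cases "a < x")
    case True then show ?thesis by (rule cdf_diff_eq)
  qed (use assms in auto)
  also have "\<dots> = (LINT y|std_normal_distribution. indicator {a<..x} y)"
    by simp
  also have "\<dots> = (LINT y:{a<..x}|lborel. std_normal_density y)"
    unfolding set_lebesgue_integral_def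
    by (subst integral_density) (auto simp: mult.commute)
  also have "\<dots> = (LINT y:{a..x}|lborel. std_normal_density y)"
  proof (rule set_integral_null_delta)
    have "sym_diff {a<..x} {a..x} = (if a \<le> x then {a} else {})" by auto
    then show "sym_diff {a<..x} {a..x} \<in> null_sets lborel" by auto
  qed auto
  also have "\<dots> = integral {a..x} std_normal_density"
    using integrable_mult_indicator[of "{a..x}" lborel std_normal_density]
    by (intro set_borel_integral_eq_integral) (auto simp: set_integrable_def)
  finally show ?thesis by simp
qed

lemma std_normal_cdf_deriv:
  "(\<Phi> has_real_derivative std_normal_density x) (at x)"
proof -
  \<comment> \<open>The base point \<open>x - 1\<close> puts \<open>x\<close> in the interior of a
    compact interval, where the fundamental theorem of calculus yields a two-sided
    derivative.\<close>
  define F where "F y = \<Phi> (x - 1) + integral {x - 1..y} std_normal_density" for y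
  have "((\<lambda>y. integral {x - 1..y} std_normal_density) has_real_derivative std_normal_density x)
          (at x within {x - 1..x + 1})"
    by (rule integral_has_real_derivative)
      (auto intro!: continuous_at_imp_continuous_on DERIV_isCont[OF std_normal_density_deriv])
  from DERIV_add[OF DERIV_const[of "\<Phi> (x - 1)"] this]
  have "(F has_real_derivative std_normal_density x) (at x within {x - 1..x + 1})"
    by (simp add: F_def[abs_def])
  moreover have "at x within {x - 1..x + 1} = at x"
    by (rule at_within_interior) simp
  ultimately have "(F has_real_derivative std_normal_density x) (at x)"
    by simp
  then show ?thesis
  proof (rule has_field_derivative_transform_within_open)
    show "F y = \<Phi> y" if "y \<in> {x - 1<..<x + 1}" for y
      using std_normal_cdf_eq_integral[of "x - 1" y] that by (simp add: F_def)
  qed auto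
qed

text \<open>The density is even, so \<open>\<Phi> x + \<Phi> (- x)\<close> has derivative zero; its
  constant value is read off at infinity.\<close>

lemma std_normal_cdf_uminus: "\<Phi> (- x) = 1 - \<Phi> x"
proof -
  define s where "s x = \<Phi> x + \<Phi> (- x)" for x
  have "(s has_real_derivative 0) (at x)" for x
  proof -
    have "((\<lambda>x. \<Phi> (- x)) has_real_derivative std_normal_density (- x) * - 1) (at x)"
      by (rule DERIV_chain'[OF _ std_normal_cdf_deriv]) (auto intro!: derivative_eq_intros)
    from DERIV_add[OF std_normal_cdf_deriv this] show ?thesis
      by (simp add: s_def[abs_def] std_normal_density_def)
  qed
  then have const: "s y = s x" for y by (metis DERIV_isconst_all)
  have lim: "(s \<longlongrightarrow> 1 + 0) at_top"
    unfolding s_def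
    by (intro tendsto_add std_normal_cdf_limits filterlim_compose[OF std_normal_cdf_limits(2)]
          filterlim_uminus_at_bot_at_top)
  have "(s \<longlongrightarrow> s x) at_top"
    by (rule tendsto_eventually, rule always_eventually) (use const in blast)
  from tendsto_unique[OF _ this lim] have "s x = 1" by simp
  then show ?thesis by (simp add: s_def)
qed

text \<open>Markov's inequality for the square. This crude decay suffices to make
  \<open>a * \<Phi> (- a)\<close> vanish at infinity.\<close>

lemma std_normal_cdf_tail:
  assumes "a > 0"
  shows "\<Phi> (- a) \<le> 1 / a\<^sup>2"
proof -
  interpret real_distribution std_normal_distribution by (rule real_dist_normal_dist)
  have int: "integrable std_normal_distribution (\<lambda>x. x\<^sup>2)"
    by (rule integrable_std_normal_distribution_moment)
  have "\<Phi> (- a) = (LINT y|std_normal_distribution. indicator {..-a} y)"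
    by (simp add: cdf_def)
  also have "\<dots> \<le> (LINT y|std_normal_distribution. y\<^sup>2 / a\<^sup>2)"
  proof (rule integral_mono)
    show "integrable std_normal_distribution (\<lambda>y. y\<^sup>2 / a\<^sup>2)" using int by simp
    show "indicator {..- a} y \<le> y\<^sup>2 / a\<^sup>2" for y
      using assms power_mono[of a "-y" 2] by (auto simp: indicator_def)
    show "integrable std_normal_distribution (indicat_real {..- a})"
      by (rule integrable_const_bound[where B = 1]) (auto simp: indicator_def)
  qed
  also have "\<dots> = 1 / a\<^sup>2"
    using std_normal_distribution_even_moments(1)[of 1] by simp
  finally show ?thesis .
qed

text \<open>Stands in for a limit at minus infinity: the next two lemmas bound a nondecreasing
  function at \<open>- a\<close> from below by \<open>- 2 / a\<close> and let \<open>a\<close>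
  grow.\<close>

lemma nonneg_if_ge_neg_inverse:
  fixes r :: real
  assumes "\<And>a. a > 0 \<Longrightarrow> a \<ge> b \<Longrightarrow> - 2 / a \<le> r"
  shows "0 \<le> r"
proof -
  have "\<forall>\<^sub>F a in at_top. - 2 / a \<le> r"
    using eventually_gt_at_top[of "max 0 b"] by (rule eventually_mono) (use assms in auto)
  moreover have "((\<lambda>a::real. - 2 / a) \<longlongrightarrow> 0) at_top"
    by (intro tendsto_divide_0[OF tendsto_const] filterlim_at_top_imp_at_infinity filterlim_ident)
  ultimately show ?thesis by (intro tendsto_upperbound) auto
qed

text \<open>The derivative of the expression is \<open>\<Phi> w\<close>, hence nonnegative, and by
  the tail bound its values far to the left are at least \<open>- 1 / a\<close>.\<close>

lemma std_normal_cdf_first_order_nonneg: "0 \<le> std_normal_density w + w * \<Phi> w"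
proof -
  define r where "r w = std_normal_density w + w * \<Phi> w" for w
  have "(r has_real_derivative \<Phi> x) (at x)" for x
    unfolding r_def[abs_def]
    by (auto intro!: derivative_eq_intros std_normal_density_deriv std_normal_cdf_deriv)
  then have mono: "r v \<le> r w" if "v \<le> w" for v w
    using DERIV_nonneg_imp_nondecreasing[OF that, of r] std_normal_cdf_bounds by blast
  have "- 2 / a \<le> r w" if "a > 0" "a \<ge> - w" for a
  proof -
    have "- 2 / a \<le> - a * (1 / a\<^sup>2)" using that by (simp add: power2_eq_square divide_right_mono)
    also have "\<dots> \<le> - a * \<Phi> (- a)"
      using std_normal_cdf_tail[OF that(1)] that by (intro mult_left_mono_neg) auto
    also have "\<dots> \<le> r (- a)" by (simp add: r_def)
    also have "\<dots> \<le> r w" by (rule mono) (use that in simp)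
    finally show ?thesis .
  qed
  then have "0 \<le> r w" by (rule nonneg_if_ge_neg_inverse)
  then show ?thesis by (simp add: r_def)
qed

text \<open>The derivative is twice the expression of the preceding lemma, so the same argument
  works one order higher.\<close>

lemma std_normal_cdf_second_order_nonneg: "0 \<le> (1 + w\<^sup>2) * \<Phi> w + w * std_normal_density w"
proof -
  define s where "s w = (1 + w\<^sup>2) * \<Phi> w + w * std_normal_density w" for w
  have deriv: "(s has_real_derivative 2 * (std_normal_density x + x * \<Phi> x)) (at x)" for x
  proof -
    have "(s has_real_derivative
        (1 + x\<^sup>2) * std_normal_density x + (2 * x) * \<Phi> x
        + (x * (- x * std_normal_density x) + 1 * std_normal_density x)) (at x)"
      unfolding s_def[abs_def]
      by (intro DERIV_add DERIV_mult' std_normal_density_deriv std_normal_cdf_deriv DERIV_ident)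
        (auto intro!: derivative_eq_intros)
    then show ?thesis by (simp add: algebra_simps power2_eq_square)
  qed
  have mono: "s v \<le> s w" if "v \<le> w" for v w
  proof (rule DERIV_nonneg_imp_nondecreasing[OF that])
    show "\<exists>y. (s has_real_derivative y) (at x) \<and> 0 \<le> y" for x
      using deriv[of x] std_normal_cdf_first_order_nonneg[of x] by (metis mult_2 add_nonneg_nonneg)
  qed
  \<comment> \<open>At \<open>- a\<close> only the density term can be negative, and
    \<open>exp t \<ge> t\<close> for \<open>t = a\<^sup>2 / 2\<close> bounds it by
    \<open>2 / a\<close> in absolute value.\<close>
  have "- 2 / a \<le> s w" if a: "a > 0" "a \<ge> - w" for a
  proof -
    have "a\<^sup>2 / 2 \<le> exp (a\<^sup>2 / 2)" using exp_ge_add_one_self[of "a\<^sup>2 / 2"] by linarith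
    then have "inverse (exp (a\<^sup>2 / 2)) \<le> inverse (a\<^sup>2 / 2)"
      using a by (intro le_imp_inverse_le) auto
    then have "a * inverse (exp (a\<^sup>2 / 2)) \<le> a * inverse (a\<^sup>2 / 2)"
      using a by (intro mult_left_mono) auto
    also have "\<dots> = 2 / a" using a by (simp add: power2_eq_square field_simps)
    finally have "a * exp (- a\<^sup>2 / 2) \<le> 2 / a" by (simp add: exp_minus)
    moreover have "1 / sqrt (2 * pi) \<le> 1" using pi_gt3 by (simp add: field_simps)
    ultimately have "1 / sqrt (2 * pi) * (a * exp (- a\<^sup>2 / 2)) \<le> 1 * (2 / a)"
      using a by (intro mult_mono) auto
    then have "- 2 / a \<le> - a * std_normal_density (- a)"
      by (simp add: std_normal_density_def mult_ac)
    also have "\<dots> \<le> s (- a)" by (simp add: s_def std_normal_cdf_bounds)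
    also have "\<dots> \<le> s w" by (rule mono) (use a in simp)
    finally show ?thesis .
  qed
  then have "0 \<le> s w" by (rule nonneg_if_ge_neg_inverse)
  then show ?thesis by (simp add: s_def)
qed

section \<open>Mills ratio\<close>

text \<open>This is the classical Mills ratio of the upper tail, taken at \<open>- w\<close>. It
  solves \<open>g' = 1 + w * g\<close>, the Stein equation with a constant right-hand side.\<close>

definition mills_ratio :: "real \<Rightarrow> real" where
  "mills_ratio w = \<Phi> w / std_normal_density w"

lemma mills_ratio_deriv: "(mills_ratio has_real_derivative 1 + w * mills_ratio w) (at w)"
proof -
  have "std_normal_density w > 0" by (simp add: normal_density_pos)
  then show ?thesis
    unfolding mills_ratio_def[abs_def]
    by (auto intro!: derivative_eq_intros std_normal_density_deriv std_normal_cdf_deriv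
             simp: field_simps)
qed

lemma mills_ratio_uminus_deriv:
  "((\<lambda>w. mills_ratio (- w)) has_real_derivative w * mills_ratio (- w) - 1) (at w)"
proof -
  have "((\<lambda>w. mills_ratio (- w)) has_real_derivative (1 + (- w) * mills_ratio (- w)) * - 1) (at w)"
    by (rule DERIV_chain2[OF mills_ratio_deriv]) (auto intro!: derivative_eq_intros)
  then show ?thesis by (simp add: minus_mult_commute)
qed

lemma mills_ratio_nonneg: "0 \<le> mills_ratio w"
  by (simp add: mills_ratio_def std_normal_cdf_bounds)

lemma mult_mills_ratio_ge: "- 1 \<le> w * mills_ratio w"
  using std_normal_cdf_first_order_nonneg[of w] normal_density_pos[of 1 0 w]
  by (simp add: mills_ratio_def field_simps)

text \<open>The derivative \<open>(1 + x\<^sup>2) * mills_ratio x + x\<close> is the second-order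
  expression above divided by the density.\<close>

lemma mult_mills_ratio_mono:
  assumes "v \<le> w"
  shows "v * mills_ratio v \<le> w * mills_ratio w"
proof (rule DERIV_nonneg_imp_nondecreasing[OF assms])
  fix x
  have "((\<lambda>x. x * mills_ratio x) has_real_derivative (1 + x\<^sup>2) * mills_ratio x + x) (at x)"
    by (auto intro!: derivative_eq_intros mills_ratio_deriv simp: algebra_simps power2_eq_square)
  moreover have "0 \<le> (1 + x\<^sup>2) * mills_ratio x + x"
    using std_normal_cdf_second_order_nonneg[of x] normal_density_pos[of 1 0 x]
    by (simp add: mills_ratio_def field_simps)
  ultimately show "\<exists>y. ((\<lambda>x. x * mills_ratio x) has_real_derivative y) (at x) \<and> 0 \<le> y" by blast
qed

section \<open>Stein solution and the oscillation of its derivative\<close>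

text \<open>The bounded solution of \<open>f' w - w * f w = of_bool (w \<le> z) - \<Phi> z\<close>, which has a kink at \<open>z\<close>;
  the value of \<open>stein_deriv\<close> there is the left derivative.\<close>

definition stein_sol :: "real \<Rightarrow> real \<Rightarrow> real" where
  "stein_sol z w = (if w \<le> z then (1 - \<Phi> z) * mills_ratio w else \<Phi> z * mills_ratio (- w))"

definition stein_deriv :: "real \<Rightarrow> real \<Rightarrow> real" where
  "stein_deriv z w = w * stein_sol z w + of_bool (w \<le> z) - \<Phi> z"

text \<open>Up to a constant, \<open>stein_deriv\<close> is the increasing function
  \<open>w * stein_sol z w\<close> minus the step \<open>of_bool (w > z)\<close>. Adding the step
  instead gives an increasing function whose increments dominate the oscillation of
  \<open>stein_deriv\<close>.\<close>

definition stein_mono :: "real \<Rightarrow> real \<Rightarrow> real" where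
  "stein_mono z w = w * stein_sol z w + of_bool (w > z)"

lemma stein_sol_ge_eq: "w \<ge> z \<Longrightarrow> stein_sol z w = \<Phi> z * mills_ratio (- w)"
  using std_normal_cdf_uminus[of z]
  by (cases "w = z") (auto simp: stein_sol_def mills_ratio_def normal_density_def)

lemma stein_sol_mult_mono:
  assumes "v \<le> w"
  shows "v * stein_sol z v \<le> w * stein_sol z w"
proof -
  have 1: "v * stein_sol z v \<le> w * stein_sol z w" if "v \<le> w" "w \<le> z" for v w
    using that mult_left_mono[OF mult_mills_ratio_mono[OF that(1)], of "1 - \<Phi> z"]
      std_normal_cdf_bounds(2)[of z] by (auto simp: stein_sol_def algebra_simps)
  have 2: "v * stein_sol z v \<le> w * stein_sol z w" if "v \<le> w" "z \<le> v" for v w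
    using that mult_left_mono[OF mult_mills_ratio_mono[of "- w" "- v"], of "\<Phi> z"]
      std_normal_cdf_bounds(1)[of z] by (auto simp: stein_sol_ge_eq algebra_simps)
  show ?thesis
    using 1[OF assms] 2[OF assms] 1[of v z] 2[of z w] by linarith
qed

text \<open>The first-order inequality gives \<open>mills_ratio w * \<bar>w\<bar> \<le> 1\<close>
  for \<open>w \<le> 0\<close>. This settles the cases where the ratio is taken at a nonpositive
  argument; between 0 and \<open>z\<close> the smallness of the coefficient allows a passage to the
  reflected ratio.\<close>

lemma stein_sol_mult_bounds: "\<bar>w * stein_sol z w\<bar> \<le> 1"
proof -
  have b: "mills_ratio w * \<bar>w\<bar> \<le> 1" if "w \<le> 0" for w
    using mult_mills_ratio_ge[of w] that by (auto simp: mult.commute)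
  have pz: "0 \<le> \<Phi> z" "\<Phi> z \<le> 1" by (rule std_normal_cdf_bounds)+
  consider "w \<le> 0" "w \<le> z" | "w \<ge> 0" "w \<ge> z" | "0 < w" "w < z" | "w < 0" "w > z" by linarith
  then show ?thesis
  proof cases
    case 1
    have "\<bar>w * stein_sol z w\<bar> = (1 - \<Phi> z) * (mills_ratio w * \<bar>w\<bar>)"
      using 1 pz mills_ratio_nonneg[of w] by (simp add: stein_sol_def abs_mult)
    also have "\<dots> \<le> 1 * 1" using b[OF 1(1)] pz mills_ratio_nonneg[of w] by (intro mult_mono) auto
    finally show ?thesis by simp
  next
    case 2
    have "\<bar>w * stein_sol z w\<bar> = \<Phi> z * (mills_ratio (- w) * \<bar>- w\<bar>)"
      using 2 pz mills_ratio_nonneg[of "- w"] by (simp add: stein_sol_ge_eq abs_mult)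
    also have "\<dots> \<le> 1 * 1" using b[of "- w"] 2 pz mills_ratio_nonneg[of "- w"] by (intro mult_mono) auto
    finally show ?thesis by simp
  next
    case 3
    \<comment> \<open>The coefficient \<open>1 - \<Phi> z\<close> becomes the numerator of the ratio
      at \<open>- w\<close>, while the original numerator \<open>\<Phi> w\<close> is bounded by
      1.\<close>
    have le: "1 - \<Phi> z \<le> \<Phi> (- w)"
      using std_normal_cdf_mono[of w z] 3 by (simp add: std_normal_cdf_uminus)
    have "\<bar>w * stein_sol z w\<bar> = (1 - \<Phi> z) * (\<Phi> w / std_normal_density w) * w"
      using 3 pz std_normal_cdf_bounds[of w] by (simp add: stein_sol_def abs_mult mills_ratio_def)
    also have "\<dots> \<le> \<Phi> (- w) * (1 / std_normal_density w) * w"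
      using 3 std_normal_cdf_bounds(2)[of w] le pz std_normal_cdf_bounds(1)[of w]
      by (intro mult_right_mono mult_mono divide_right_mono) (auto simp: std_normal_cdf_bounds)
    also have "\<dots> = mills_ratio (- w) * \<bar>- w\<bar>"
      using 3 by (simp add: mills_ratio_def std_normal_density_def)
    also have "\<dots> \<le> 1" using b[of "- w"] 3 by simp
    finally show ?thesis .
  next
    case 4
    have "\<bar>w * stein_sol z w\<bar> = \<Phi> z * (\<Phi> (- w) / std_normal_density (- w)) * \<bar>w\<bar>"
      using 4 pz std_normal_cdf_bounds[of "-w"] by (simp add: stein_sol_def abs_mult mills_ratio_def)
    also have "\<dots> \<le> \<Phi> w * (1 / std_normal_density (- w)) * \<bar>w\<bar>"
      using 4 std_normal_cdf_bounds[of "-w"] std_normal_cdf_mono[of z w] pz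
      by (intro mult_right_mono mult_mono divide_right_mono) (auto simp: std_normal_cdf_bounds)
    also have "\<dots> = mills_ratio w * \<bar>w\<bar>"
      using 4 by (simp add: mills_ratio_def std_normal_density_def)
    also have "\<dots> \<le> 1" using b[of "w"] 4 by simp
    finally show ?thesis .
  qed
qed

lemma stein_deriv_bound: "\<bar>stein_deriv z w\<bar> \<le> 2"
  using stein_sol_mult_bounds[of w z] std_normal_cdf_bounds[of z]
  by (auto simp: stein_deriv_def abs_le_iff)

lemma stein_mono_bound: "\<bar>stein_mono z w\<bar> \<le> 2"
  using stein_sol_mult_bounds[of w z] by (auto simp: stein_mono_def abs_le_iff)

lemma stein_sol_deriv:
  assumes "w \<noteq> z"
  shows "(stein_sol z has_real_derivative stein_deriv z w) (at w)"
proof (cases "w < z")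
  case True
  have "((\<lambda>w. (1 - \<Phi> z) * mills_ratio w) has_real_derivative (1 - \<Phi> z) * (1 + w * mills_ratio w)) (at w)"
    by (auto intro!: derivative_eq_intros mills_ratio_deriv)
  then have "(stein_sol z has_real_derivative (1 - \<Phi> z) * (1 + w * mills_ratio w)) (at w)"
    by (rule has_field_derivative_transform_within_open[of _ _ _ "{..<z}"]) (use True in \<open>auto simp: stein_sol_def\<close>)
  then show ?thesis using True by (simp add: stein_deriv_def stein_sol_def algebra_simps)
next
  case False
  have "((\<lambda>w. \<Phi> z * mills_ratio (- w)) has_real_derivative \<Phi> z * (w * mills_ratio (- w) - 1)) (at w)"
    by (intro DERIV_cmult mills_ratio_uminus_deriv)
  then have "(stein_sol z has_real_derivative \<Phi> z * (w * mills_ratio (- w) - 1)) (at w)"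
    by (rule has_field_derivative_transform_within_open[of _ _ _ "{z<..}"]) (use False assms in \<open>auto simp: stein_sol_def\<close>)
  then show ?thesis using False assms by (simp add: stein_deriv_def stein_sol_def algebra_simps)
qed

lemma stein_sol_continuous: "continuous_on A (stein_sol z)"
proof -
  have m: "continuous_on A mills_ratio" for A
    by (intro continuous_at_imp_continuous_on ballI DERIV_isCont[OF mills_ratio_deriv])
  have m': "continuous_on A (\<lambda>w. mills_ratio (- w))" for A
    by (intro continuous_at_imp_continuous_on ballI DERIV_isCont[OF mills_ratio_uminus_deriv])
  have "continuous_on ({..z} \<union> {z..}) (stein_sol z)"
  proof (rule continuous_on_closed_Un)
    have "continuous_on {..z} (\<lambda>w. (1 - \<Phi> z) * mills_ratio w)"
      by (intro continuous_intros m)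
    then show "continuous_on {..z} (stein_sol z)"
      by (rule continuous_on_eq) (auto simp: stein_sol_def)
    have "continuous_on {z..} (\<lambda>w. \<Phi> z * mills_ratio (- w))"
      by (intro continuous_intros m')
    then show "continuous_on {z..} (stein_sol z)"
      by (rule continuous_on_eq) (auto simp: stein_sol_ge_eq)
  qed auto
  moreover have "{..z} \<union> {z..} = UNIV" by auto
  ultimately show ?thesis by (metis continuous_on_subset subset_UNIV)
qed

text \<open>Mean value inequality for a function with one kink: split the interval at the kink and
  add the two estimates.\<close>

lemma increment_bounds_except_point:
  fixes f :: "real \<Rightarrow> real"
  assumes "a \<le> b" and cont: "continuous_on {a..b} f"
    and deriv: "\<And>x. a < x \<Longrightarrow> x < b \<Longrightarrow> x \<noteq> z \<Longrightarrow> (f has_real_derivative f' x) (at x)"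
    and bounds: "\<And>x. a < x \<Longrightarrow> x < b \<Longrightarrow> L \<le> f' x \<and> f' x \<le> U"
  shows "(b - a) * L \<le> f b - f a \<and> f b - f a \<le> (b - a) * U"
proof -
  have seg: "(d - c) * L \<le> f d - f c \<and> f d - f c \<le> (d - c) * U"
    if "a \<le> c" "c \<le> d" "d \<le> b" "z \<notin> {c<..<d}" for c d
  proof (cases "c = d")
    case False
    with that have cd: "c < d" by simp
    have "continuous_on {c..d} f" by (rule continuous_on_subset[OF cont]) (use that in auto)
    moreover have der: "(f has_real_derivative f' x) (at x)" if "c < x" "x < d" for x
      using that \<open>a \<le> c\<close> \<open>d \<le> b\<close> \<open>z \<notin> _\<close> by (intro deriv) auto
    ultimately obtain l x where x: "c < x" "x < d" "(f has_real_derivative l) (at x)"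
        "f d - f c = (d - c) * l"
      using MVT[OF cd] real_differentiable_def by blast
    then have "l = f' x" using der DERIV_unique by blast
    then show ?thesis
      using x bounds[of x] that cd by (auto intro!: mult_left_mono)
  qed simp
  show ?thesis
  proof (cases "a < z \<and> z < b")
    case True
    then show ?thesis using seg[of a z] seg[of z b] by (auto simp: algebra_simps)
  next
    case False
    then show ?thesis using seg[of a b] assms(1) by auto
  qed
qed

text \<open>\<open>L\<close> and \<open>U\<close> evaluate the increasing and the decreasing part of
  \<open>stein_deriv\<close> at opposite ends, so they enclose all its values on the interval. The
  average slope and the value at \<open>w\<close> both lie in this range, whose length is the
  increment of \<open>stein_mono\<close>.\<close>

lemma stein_increment:
  assumes "a \<le> b" and "w \<in> {a, b}"
  shows "\<bar>stein_sol z b - stein_sol z a - (b - a) * stein_deriv z w\<bar>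
           \<le> (b - a) * (stein_mono z b - stein_mono z a)"
proof -
  define L where "L = a * stein_sol z a + of_bool (b \<le> z) - \<Phi> z"
  define U where "U = b * stein_sol z b + of_bool (a \<le> z) - \<Phi> z"
  have between: "L \<le> stein_deriv z x \<and> stein_deriv z x \<le> U" if "a \<le> x" "x \<le> b" for x
    using stein_sol_mult_mono[OF that(1), of z] stein_sol_mult_mono[OF that(2), of z] that
    by (auto simp: L_def U_def stein_deriv_def of_bool_def)
  have 1: "(b - a) * L \<le> stein_sol z b - stein_sol z a \<and> stein_sol z b - stein_sol z a \<le> (b - a) * U"
    by (rule increment_bounds_except_point[OF assms(1) stein_sol_continuous])
      (use between in \<open>auto intro: stein_sol_deriv\<close>)
  have 2: "(b - a) * L \<le> (b - a) * stein_deriv z w \<and> (b - a) * stein_deriv z w \<le> (b - a) * U"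
    using between[of w] assms by (auto intro!: mult_left_mono)
  have "U - L = stein_mono z b - stein_mono z a"
    by (auto simp: U_def L_def stein_mono_def of_bool_def)
  then have "(b - a) * U - (b - a) * L = (b - a) * (stein_mono z b - stein_mono z a)"
    by (metis right_diff_distrib)
  with 1 2 show ?thesis by linarith
qed

section \<open>Stein's method on a product of Bernoulli measures\<close>

definition all_true :: "'e set \<Rightarrow> ('e \<Rightarrow> bool) \<Rightarrow> real" where
  "all_true A w = of_bool (\<forall>e\<in>A. w e)"

definition disc_deriv :: "'e \<Rightarrow> (('e \<Rightarrow> bool) \<Rightarrow> real) \<Rightarrow> ('e \<Rightarrow> bool) \<Rightarrow> real" where
  "disc_deriv k F w = F (w(k := True)) - F (w(k := False))"

lemma all_true_empty [simp]: "all_true {} w = 1"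
  by (simp add: all_true_def)

lemma all_true_insert: "all_true (insert a A) w = of_bool (w a) * all_true A w"
  by (simp add: all_true_def)

lemma all_true_mult: "all_true A w * all_true B w = all_true (A \<union> B) w"
  by (auto simp: all_true_def)

lemma all_true_nonneg [simp]: "0 \<le> all_true A w"
  by (simp add: all_true_def)

lemma all_true_upd [simp]: "k \<notin> A \<Longrightarrow> all_true A (w(k := b)) = all_true A w"
  by (auto simp: all_true_def)

lemma disc_deriv_all_true:
  "disc_deriv k (all_true A) w = of_bool (k \<in> A) * all_true (A - {k}) w"
  by (auto simp: disc_deriv_def all_true_def)

lemma disc_deriv_mult_indep:
  assumes "\<And>w b. u (w(k := b)) = u w"
  shows "disc_deriv k (\<lambda>w. u w * F w) w = u w * disc_deriv k F w"
  by (simp add: disc_deriv_def assms algebra_simps)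

lemma disc_deriv_sum:
  "disc_deriv k (\<lambda>w. \<Sum>i\<in>I. F i w) w = (\<Sum>i\<in>I. disc_deriv k (F i) w)"
  by (simp add: disc_deriv_def sum_subtractf)

text \<open>Order the edges by insertion and let \<open>P k\<close> be those before
  \<open>k\<close>: in the term of \<open>k\<close>, earlier edges keep their indicators and later
  ones are already replaced by \<open>p\<close>. Since \<open>P k\<close> omits \<open>k\<close>,
  the coefficient of \<open>of_bool (w k) - p\<close> does not depend on \<open>w k\<close>; the
  choice of \<open>P\<close> depends neither on \<open>p\<close> nor on \<open>w\<close>.\<close>

lemma all_true_telescope:
  assumes "finite A"
  shows "\<exists>P. (\<forall>k\<in>A. P k \<subseteq> A - {k}) \<and>
    (\<forall>(p::real) w. all_true A w - p ^ card A =
       (\<Sum>k\<in>A. (of_bool (w k) - p) * (p ^ card (A - P k - {k}) * all_true (P k) w)))"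
  using assms
proof induction
  case empty
  then show ?case by simp
next
  case (insert a A)
  then obtain P where P: "\<And>k. k \<in> A \<Longrightarrow> P k \<subseteq> A - {k}"
    "\<And>(p::real) w. all_true A w - p ^ card A =
       (\<Sum>k\<in>A. (of_bool (w k) - p) * (p ^ card (A - P k - {k}) * all_true (P k) w))"
    by blast
  \<comment> \<open>The new edge comes last. With \<open>x\<close> its indicator,
    \<open>y = all_true A w\<close> and \<open>c = p ^ card A\<close>, the identity
    \<open>x * y - p * c = (x - p) * y + p * (y - c)\<close> adds one term and multiplies every
    older one by \<open>p\<close>.\<close>
  define P' where "P' = P(a := A)"
  have "P' k \<subseteq> insert a A - {k}" if "k \<in> insert a A" for k
    using that P(1) insert.hyps by (auto simp: P'_def)
  moreover have "all_true (insert a A) w - p ^ card (insert a A) =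
       (\<Sum>k\<in>insert a A. (of_bool (w k) - p) * (p ^ card (insert a A - P' k - {k}) * all_true (P' k) w))"
    for p :: real and w
  proof -
    have "card (insert a A - P' k - {k}) = Suc (card (A - P k - {k}))" if "k \<in> A" for k
    proof -
      have "insert a A - P' k - {k} = insert a (A - P k - {k})"
        using that P(1)[OF that] insert.hyps by (auto simp: P'_def)
      then show ?thesis using insert.hyps by simp
    qed
    then have "(\<Sum>k\<in>A. (of_bool (w k) - p) * (p ^ card (insert a A - P' k - {k}) * all_true (P' k) w))
        = (\<Sum>k\<in>A. p * ((of_bool (w k) - p) * (p ^ card (A - P k - {k}) * all_true (P k) w)))"
      using insert.hyps by (intro sum.cong) (auto simp: P'_def)
    also have "\<dots> = p * (all_true A w - p ^ card A)"
      by (simp add: P(2) sum_distrib_left)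
    finally have "(\<Sum>k\<in>A. (of_bool (w k) - p) * (p ^ card (insert a A - P' k - {k}) * all_true (P' k) w))
        = p * (all_true A w - p ^ card A)" .
    moreover have "card (insert a A - P' a - {a}) = 0" by (simp add: P'_def insert_Diff_if)
    moreover have "P' a = A" by (simp add: P'_def)
    ultimately show ?thesis
      using insert.hyps by (simp only: sum.insert power_0) (simp add: all_true_insert algebra_simps)
  qed
  ultimately show ?case by blast
qed

section \<open>Expectations under a Bernoulli product\<close>

locale bernoulli_product =
  fixes E :: "'e set" and p :: real
  assumes finite_E: "finite E" and p_pos: "0 < p" and p_less_1: "p < 1"
begin

abbreviation "M \<equiv> Pi_pmf E False (\<lambda>_. bernoulli_pmf p)"
abbreviation "expect \<equiv> measure_pmf.expectation M"

text \<open>Finite support makes every real function integrable, which removes all integrability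
  conditions below.\<close>

lemma finite_set_pmf_M: "finite (set_pmf M)"
  by (rule finite_subset[OF set_Pi_pmf_subset'])
    (auto simp: finite_E intro: finite_PiE_dflt)

lemma integrable_M [simp]: "integrable (measure_pmf M) (F :: _ \<Rightarrow> real)"
  by (rule integrable_measure_pmf_finite[OF finite_set_pmf_M])

lemma expect_mono: "(\<And>w. F w \<le> G w) \<Longrightarrow> expect F \<le> (expect G :: real)"
  by (rule integral_mono[OF integrable_M integrable_M])

lemma expect_abs_le_sqrt: "expect (\<lambda>w. \<bar>F w\<bar>) \<le> sqrt (expect (\<lambda>w. (F w)\<^sup>2))"
proof -
  have "0 \<le> measure_pmf.variance M (\<lambda>w. \<bar>F w\<bar>)"
    by (rule measure_pmf.variance_positive)
  also have "\<dots> = expect (\<lambda>w. (F w)\<^sup>2) - (expect (\<lambda>w. \<bar>F w\<bar>))\<^sup>2"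
    by (subst measure_pmf.variance_eq) auto
  finally show ?thesis by (intro real_le_rsqrt) simp
qed

lemma expect_split:
  assumes "k \<in> E"
  shows "expect F = p * expect (\<lambda>w. F (w(k := True))) + (1 - p) * expect (\<lambda>w. F (w(k := False)))"
proof -
  have "M = Pi_pmf (insert k (E - {k})) False (\<lambda>_. bernoulli_pmf p)"
    using assms by (simp add: insert_absorb)
  also have "\<dots> = bernoulli_pmf p \<bind> (\<lambda>y. Pi_pmf (E - {k}) False (\<lambda>_. bernoulli_pmf p) \<bind> (\<lambda>f. return_pmf (f(k := y))))"
    using finite_E by (subst Pi_pmf_insert') auto
  \<comment> \<open>Coordinate \<open>k\<close> is overwritten anyway, so the law on
    \<open>E - {k}\<close> may be replaced by \<open>M\<close> itself.\<close>
  also have "\<dots> = bernoulli_pmf p \<bind> (\<lambda>y. map_pmf (\<lambda>f. f(k := y)) M)"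
    by (simp add: Pi_pmf_remove[OF finite_E] map_pmf_def bind_assoc_pmf bind_return_pmf)
  finally have M: "M = bernoulli_pmf p \<bind> (\<lambda>y. map_pmf (\<lambda>f. f(k := y)) M)" .
  have "expect F = measure_pmf.expectation (bernoulli_pmf p \<bind> (\<lambda>y. map_pmf (\<lambda>f. f(k := y)) M)) F"
    using M by simp
  also have "\<dots> = (\<Sum>y\<in>UNIV. pmf (bernoulli_pmf p) y *\<^sub>R measure_pmf.expectation (map_pmf (\<lambda>f. f(k := y)) M) F)"
    by (rule pmf_expectation_bind) (auto simp: finite_set_pmf_M)
  also have "\<dots> = p * expect (\<lambda>w. F (w(k := True))) + (1 - p) * expect (\<lambda>w. F (w(k := False)))"
    using p_pos p_less_1 by (simp add: UNIV_bool)
  finally show ?thesis .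
qed

text \<open>Conditioning on coordinate \<open>k\<close> gives the two values of \<open>F\<close> the
  weights \<open>p * (1 - p)\<close> and \<open>- (1 - p) * p\<close>.\<close>

lemma expect_by_parts:
  assumes "k \<in> E"
  shows "expect (\<lambda>w. (of_bool (w k) - p) * F w) = p * (1 - p) * expect (disc_deriv k F)"
  by (subst expect_split[OF assms]) (simp add: disc_deriv_def[abs_def] algebra_simps)

lemma expect_all_true:
  assumes "A \<subseteq> E"
  shows "expect (all_true A) = p ^ card A"
proof -
  have "finite A" using assms finite_E finite_subset by blast
  then show ?thesis using assms
  proof induction
    case empty
    then show ?case by (simp add: all_true_def[abs_def])
  next
    case (insert a A)
    then have "expect (all_true (insert a A)) = p * expect (all_true A)"
      by (subst expect_split[of a]) (auto simp: all_true_insert)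
    then show ?case using insert by simp
  qed
qed

text \<open>For \<open>k = l\<close> one integration by parts suffices. Otherwise two are made, and
  the mixed derivative vanishes unless both edges lie in \<open>B\<close>. Every surviving case
  carries a factor \<open>1 - p\<close> and one factor \<open>p\<close> for each edge of
  \<open>B \<union> {k, l}\<close>.\<close>

lemma expect_centered_pair:
  assumes "k \<in> E" "l \<in> E" "B \<subseteq> E" "k = l \<Longrightarrow> k \<notin> B"
  shows "expect (\<lambda>w. (of_bool (w k) - p) * ((of_bool (w l) - p) * all_true B w))
    \<le> (1 - p) * (of_bool (k = l \<or> k \<in> B \<and> l \<in> B) * p ^ card (B \<union> {k, l}))" (is "?L \<le> _")
proof -
  have fin: "finite B" using assms finite_E finite_subset by blast
  have L: "?L = p * (1 - p) * expect (disc_deriv k (\<lambda>w. (of_bool (w l) - p) * all_true B w))"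
    by (rule expect_by_parts) fact
  show ?thesis
  proof (cases "k = l")
    case True
    then have "disc_deriv k (\<lambda>w. (of_bool (w l) - p) * all_true B w) = all_true B"
      using assms(4) by (auto simp: disc_deriv_def algebra_simps)
    then show ?thesis
      using L True assms fin p_pos p_less_1 by (simp add: expect_all_true)
  next
    case False
    have eq: "disc_deriv k (\<lambda>w. (of_bool (w l) - p) * all_true B w) =
        (\<lambda>w. (of_bool (w l) - p) * (of_bool (k \<in> B) * all_true (B - {k}) w))"
      by (rule ext, subst disc_deriv_mult_indep) (use False in \<open>auto simp: disc_deriv_all_true\<close>)
    have "expect (disc_deriv k (\<lambda>w. (of_bool (w l) - p) * all_true B w))
        = p * (1 - p) * expect (disc_deriv l (\<lambda>w. of_bool (k \<in> B) * all_true (B - {k}) w))"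
      unfolding eq by (rule expect_by_parts) fact
    also have "disc_deriv l (\<lambda>w. of_bool (k \<in> B) * all_true (B - {k}) w)
        = (\<lambda>w. of_bool (k \<in> B \<and> l \<in> B) * all_true (B - {k} - {l}) w)"
      by (rule ext, subst disc_deriv_mult_indep) (use False in \<open>auto simp: disc_deriv_all_true\<close>)
    also have "expect \<dots> = of_bool (k \<in> B \<and> l \<in> B) * p ^ card (B - {k} - {l})"
      using assms by (subst expect_all_true[symmetric]) auto
    finally have L': "?L = (1 - p)\<^sup>2 * (of_bool (k \<in> B \<and> l \<in> B) * (p\<^sup>2 * p ^ card (B - {k} - {l})))"
      using L by (simp add: power2_eq_square)
    show ?thesis
    proof (cases "k \<in> B \<and> l \<in> B")
      case True
      have "B \<union> {k, l} = B" using True by auto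
      moreover have "card B = Suc (Suc (card (B - {k} - {l})))"
        using True False fin by (metis Diff_iff card.remove finite_Diff singletonD)
      ultimately have "?L = (1 - p)\<^sup>2 * p ^ card (B \<union> {k, l})"
        using L' True by (simp add: power2_eq_square mult_ac)
      also have "\<dots> \<le> (1 - p) * p ^ card (B \<union> {k, l})"
        using p_pos p_less_1 by (intro mult_right_mono) (auto simp: power2_eq_square mult_left_le)
      finally show ?thesis using True by simp
    qed (use L' False in auto)
  qed
qed

text \<open>Integration by parts term by term; \<open>u k\<close> passes through
  \<open>disc_deriv k\<close> because it ignores coordinate \<open>k\<close>. It is applied to the
  Stein solution, and with \<open>F = W\<close> to evaluate the second moment of
  \<open>W\<close>.\<close>

lemma expect_mult_representation:
  assumes indep: "\<And>k w b. k \<in> E \<Longrightarrow> u k (w(k := b)) = u k w"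
    and repr: "\<And>w. W w = (\<Sum>k\<in>E. (of_bool (w k) - p) * u k w)"
  shows "expect (\<lambda>w. W w * F w) = (\<Sum>k\<in>E. p * (1 - p) * expect (\<lambda>w. u k w * disc_deriv k F w))"
proof -
  have "expect (\<lambda>w. W w * F w) = expect (\<lambda>w. \<Sum>k\<in>E. (of_bool (w k) - p) * (u k w * F w))"
    by (simp add: repr sum_distrib_right mult.assoc)
  also have "\<dots> = (\<Sum>k\<in>E. expect (\<lambda>w. (of_bool (w k) - p) * (u k w * F w)))"
    by (rule Bochner_Integration.integral_sum) simp
  also have "\<dots> = (\<Sum>k\<in>E. p * (1 - p) * expect (\<lambda>w. u k w * disc_deriv k F w))"
  proof (rule sum.cong)
    fix k assume k: "k \<in> E"
    have "disc_deriv k (\<lambda>w. u k w * F w) = (\<lambda>w. u k w * disc_deriv k F w)"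
      by (rule ext, rule disc_deriv_mult_indep) (rule indep[OF k])
    then show "expect (\<lambda>w. (of_bool (w k) - p) * (u k w * F w))
        = p * (1 - p) * expect (\<lambda>w. u k w * disc_deriv k F w)"
      by (simp add: expect_by_parts[OF k])
  qed simp
  finally show ?thesis .
qed

section \<open>Abstract Kolmogorov bound\<close>

text \<open>The first expectation measures how far the Stein kernel
  \<open>p * (1 - p) * (\<Sum>k\<in>E. u k w * disc_deriv k W w)\<close> is from 1, the second the
  effect of the variation of \<open>stein_deriv\<close>. The factors 2 are the uniform bounds on
  \<open>stein_deriv\<close> and \<open>stein_mono\<close>.\<close>

theorem stein_kolmogorov_bound:
  assumes indep: "\<And>k w b. k \<in> E \<Longrightarrow> u k (w(k := b)) = u k w"
    and u_nonneg: "\<And>k w. k \<in> E \<Longrightarrow> 0 \<le> u k w"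
    and incr: "\<And>k w. k \<in> E \<Longrightarrow> 0 \<le> disc_deriv k W w"
    and repr: "\<And>w. W w = (\<Sum>k\<in>E. (of_bool (w k) - p) * u k w)"
  shows "\<bar>measure_pmf.prob M {w. W w \<le> z} - \<Phi> z\<bar>
    \<le> 2 * expect (\<lambda>w. \<bar>1 - p * (1 - p) * (\<Sum>k\<in>E. u k w * disc_deriv k W w)\<bar>)
      + 2 * expect (\<lambda>w. \<bar>\<Sum>k\<in>E. (of_bool (w k) - p) * (u k w * disc_deriv k W w)\<bar>)"
proof -
  define f where "f = stein_sol z"
  define f' where "f' = stein_deriv z"
  define h where "h = stein_mono z"
  define V where "V w = p * (1 - p) * (\<Sum>k\<in>E. u k w * disc_deriv k W w)" for w
  define Y where "Y w = (\<Sum>k\<in>E. (of_bool (w k) - p) * (u k w * disc_deriv k W w))" for w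
  have pq: "0 \<le> p * (1 - p)" using p_pos p_less_1 by simp
  have Wf: "expect (\<lambda>w. W w * f (W w)) = (\<Sum>k\<in>E. p * (1 - p) * expect (\<lambda>w. u k w * disc_deriv k (\<lambda>w. f (W w)) w))"
    by (rule expect_mult_representation[OF indep repr])
  have Vf: "expect (\<lambda>w. V w * f' (W w)) = (\<Sum>k\<in>E. p * (1 - p) * expect (\<lambda>w. u k w * (disc_deriv k W w * f' (W w))))"
    by (simp add: V_def sum_distrib_right sum_distrib_left mult.assoc)
  have Dind: "disc_deriv k W (w(k := b)) = disc_deriv k W w" for k w b
    by (simp add: disc_deriv_def)
  \<comment> \<open>Linearisation error in coordinate \<open>k\<close>: \<open>W w\<close> is one of
    the two values obtained by setting that coordinate, as \<open>stein_increment\<close> requires.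
    Since \<open>u k\<close> and \<open>disc_deriv k W\<close> ignore coordinate \<open>k\<close>,
    the resulting bound is the discrete derivative of a single product.\<close>
  have step: "\<bar>u k w * disc_deriv k (\<lambda>w. f (W w)) w - u k w * (disc_deriv k W w * f' (W w))\<bar>
      \<le> disc_deriv k (\<lambda>w. (u k w * disc_deriv k W w) * h (W w)) w" if k: "k \<in> E" for k w
  proof -
    define a b where "a = W (w(k := False))" and "b = W (w(k := True))"
    have "a \<le> b" using incr[OF k, of w] by (simp add: disc_deriv_def a_def b_def)
    moreover have "W w \<in> {a, b}"
    proof -
      have "w = w(k := w k)" by simp
      then have "w = w(k := True) \<or> w = w(k := False)" by (cases "w k") auto
      then show ?thesis by (auto simp: a_def b_def)
    qed
    ultimately have "\<bar>f b - f a - (b - a) * f' (W w)\<bar> \<le> (b - a) * (h b - h a)"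
      unfolding f_def f'_def h_def by (rule stein_increment)
    then have "u k w * \<bar>f b - f a - (b - a) * f' (W w)\<bar> \<le> u k w * ((b - a) * (h b - h a))"
      using u_nonneg[OF k] by (rule mult_left_mono)
    moreover have "u k w * disc_deriv k (\<lambda>w. f (W w)) w - u k w * (disc_deriv k W w * f' (W w))
        = u k w * (f b - f a - (b - a) * f' (W w))"
      by (simp add: disc_deriv_def a_def b_def algebra_simps)
    moreover have "disc_deriv k (\<lambda>w. (u k w * disc_deriv k W w) * h (W w)) w
        = u k w * ((b - a) * (h b - h a))"
      by (subst disc_deriv_mult_indep) (auto simp: indep[OF k] Dind, simp add: disc_deriv_def a_def b_def)
    ultimately show ?thesis using u_nonneg[OF k, of w] by (simp add: abs_mult)
  qed
  have "\<bar>expect (\<lambda>w. W w * f (W w)) - expect (\<lambda>w. V w * f' (W w))\<bar>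
      = \<bar>\<Sum>k\<in>E. p * (1 - p) * expect (\<lambda>w. u k w * disc_deriv k (\<lambda>w. f (W w)) w - u k w * (disc_deriv k W w * f' (W w)))\<bar>"
    unfolding Wf Vf by (simp add: sum_subtractf right_diff_distrib)
  also have "\<dots> \<le> (\<Sum>k\<in>E. p * (1 - p) * expect (disc_deriv k (\<lambda>w. (u k w * disc_deriv k W w) * h (W w))))"
  proof (rule order_trans[OF sum_abs sum_mono])
    fix k assume k: "k \<in> E"
    have "\<bar>expect (\<lambda>w. u k w * disc_deriv k (\<lambda>w. f (W w)) w - u k w * (disc_deriv k W w * f' (W w)))\<bar>
        \<le> expect (\<lambda>w. \<bar>u k w * disc_deriv k (\<lambda>w. f (W w)) w - u k w * (disc_deriv k W w * f' (W w))\<bar>)"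
      by (rule integral_abs_bound)
    also have "\<dots> \<le> expect (disc_deriv k (\<lambda>w. (u k w * disc_deriv k W w) * h (W w)))"
      by (rule expect_mono) (rule step[OF k])
    finally show "\<bar>p * (1 - p) * expect (\<lambda>w. u k w * disc_deriv k (\<lambda>w. f (W w)) w - u k w * (disc_deriv k W w * f' (W w)))\<bar>
       \<le> p * (1 - p) * expect (disc_deriv k (\<lambda>w. (u k w * disc_deriv k W w) * h (W w)))"
      using pq by (simp only: abs_mult[of "p * (1 - p)"] abs_of_nonneg mult_left_mono)
  qed
  \<comment> \<open>Undoing the integration by parts replaces increments of \<open>h\<close> by
    values of \<open>h\<close>, for which the uniform bound is enough.\<close>
  also have "\<dots> = (\<Sum>k\<in>E. expect (\<lambda>w. (of_bool (w k) - p) * ((u k w * disc_deriv k W w) * h (W w))))"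
    by (intro sum.cong refl expect_by_parts[symmetric])
  also have "\<dots> = expect (\<lambda>w. Y w * h (W w))"
    by (simp add: Y_def sum_distrib_right mult.assoc)
  also have "\<dots> \<le> expect (\<lambda>w. 2 * \<bar>Y w\<bar>)"
  proof (rule expect_mono)
    fix w
    have "Y w * h (W w) \<le> \<bar>Y w\<bar> * \<bar>h (W w)\<bar>" by (metis abs_ge_self abs_mult)
    also have "\<dots> \<le> \<bar>Y w\<bar> * 2" unfolding h_def by (intro mult_left_mono stein_mono_bound) auto
    finally show "Y w * h (W w) \<le> 2 * \<bar>Y w\<bar>" by simp
  qed
  finally have part2: "\<bar>expect (\<lambda>w. W w * f (W w)) - expect (\<lambda>w. V w * f' (W w))\<bar> \<le> 2 * expect (\<lambda>w. \<bar>Y w\<bar>)"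
    by simp
  have "\<bar>expect (\<lambda>w. f' (W w) * (1 - V w))\<bar> \<le> expect (\<lambda>w. \<bar>f' (W w) * (1 - V w)\<bar>)"
    by (rule integral_abs_bound)
  also have "\<dots> \<le> expect (\<lambda>w. 2 * \<bar>1 - V w\<bar>)"
    unfolding f'_def abs_mult by (intro expect_mono mult_right_mono stein_deriv_bound) auto
  finally have part1: "\<bar>expect (\<lambda>w. f' (W w) * (1 - V w))\<bar> \<le> 2 * expect (\<lambda>w. \<bar>1 - V w\<bar>)"
    by simp
  have "measure_pmf.prob M {w. W w \<le> z} = expect (\<lambda>w. of_bool (W w \<le> z))"
  proof -
    have "expect (\<lambda>w. of_bool (W w \<le> z)) = expect (indicat_real {w. W w \<le> z})"
      by (rule Bochner_Integration.integral_cong) (auto simp: indicator_def)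
    also have "\<dots> = measure_pmf.prob M {w. W w \<le> z}" by simp
    finally show ?thesis by simp
  qed
  \<comment> \<open>Stein's equation evaluated at \<open>W w\<close>.\<close>
  moreover have "expect (\<lambda>w. f' (W w)) = expect (\<lambda>w. W w * f (W w)) + expect (\<lambda>w. of_bool (W w \<le> z)) - \<Phi> z"
    by (simp add: f'_def f_def stein_deriv_def)
  ultimately have "measure_pmf.prob M {w. W w \<le> z} - \<Phi> z = expect (\<lambda>w. f' (W w)) - expect (\<lambda>w. W w * f (W w))"
    by simp
  also have "expect (\<lambda>w. f' (W w)) = expect (\<lambda>w. f' (W w) * (1 - V w)) + expect (\<lambda>w. V w * f' (W w))"
    by (subst Bochner_Integration.integral_add[symmetric]) (auto simp: algebra_simps)
  finally show ?thesis
    using part1 part2 unfolding V_def Y_def by linarith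
qed

end

section \<open>Counts of products of indicators\<close>

text \<open>Controls both second moments up to powers of \<open>1 - p\<close>. As \<open>t\<close>
  and \<open>s\<close> will each carry a pair of copies with a chosen common edge, the sum runs over
  quadruples whose two pairs meet.\<close>

definition overlap_sum :: "real \<Rightarrow> 't set \<Rightarrow> ('t \<Rightarrow> 'e set) \<Rightarrow> real" where
  "overlap_sum p Q U = (\<Sum>t\<in>Q. \<Sum>s\<in>Q. of_bool (U t \<inter> U s \<noteq> {}) * p ^ card (U t \<union> U s))"

lemma power_card_le_of_subset_Un:
  fixes p :: real
  assumes "0 \<le> p" "p \<le> 1" "U \<subseteq> A \<union> B \<union> C" "finite A" "finite B" "finite C"
  shows "p ^ card A * p ^ card B * p ^ card C \<le> p ^ card U"
proof -
  have "card U \<le> card (A \<union> B \<union> C)" by (rule card_mono) (use assms in auto)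
  also have "\<dots> \<le> card A + card B + card C"
    using card_Un_le[of "A \<union> B" C] card_Un_le[of A B] by linarith
  finally have "p ^ (card A + card B + card C) \<le> p ^ card U"
    using assms by (intro power_decreasing) auto
  then show ?thesis by (simp add: power_add)
qed

context bernoulli_product
begin

text \<open>In the application \<open>t = (k, i, j)\<close> is an edge \<open>k\<close> common to two copies, \<open>U t\<close> is the union of the
  copies, and \<open>p ^ card (R t) * all_true (A t)\<close> is a summand of \<open>u k * D k W\<close>.\<close>

context
  fixes Q :: "'t set" and R A U :: "'t \<Rightarrow> 'e set" and K :: "'t \<Rightarrow> 'e"
  assumes R: "\<And>t. t \<in> Q \<Longrightarrow> R t \<subseteq> E"
    and A: "\<And>t. t \<in> Q \<Longrightarrow> A t \<subseteq> E"
    and K: "\<And>t. t \<in> Q \<Longrightarrow> K t \<in> E \<and> K t \<notin> A t \<and> K t \<in> U t"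
    and U: "\<And>t. t \<in> Q \<Longrightarrow> A t \<subseteq> U t \<and> U t \<subseteq> R t \<union> A t \<union> {K t}"
begin

lemma fin_RA: "t \<in> Q \<Longrightarrow> finite (R t)" "t \<in> Q \<Longrightarrow> finite (A t)"
  using finite_subset[OF R finite_E] finite_subset[OF A finite_E] by auto

text \<open>\<open>R t\<close>, \<open>A t\<close> and \<open>K t\<close> cover \<open>U t\<close>,
  so the left side counts every edge of \<open>U t \<union> U s\<close> at least once in its
  exponents.\<close>

lemma weighted_union_le:
  assumes t: "t \<in> Q" and s: "s \<in> Q"
  shows "p ^ card (R t) * p ^ card (R s) * p ^ card (A t \<union> A s \<union> {K t, K s}) \<le> p ^ card (U t \<union> U s)"
  by (rule power_card_le_of_subset_Un)
    (use U[OF t] U[OF s] p_pos p_less_1 fin_RA t s in auto)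

text \<open>Terms with disjoint \<open>A t\<close> and \<open>A s\<close> are uncorrelated. In the
  others \<open>U t\<close> meets \<open>U s\<close>, and the product of the means is
  dropped.\<close>

lemma variance_le_overlap_sum:
  defines "V \<equiv> \<lambda>w. p * (1 - p) * (\<Sum>t\<in>Q. p ^ card (R t) * all_true (A t) w)"
  shows "expect (\<lambda>w. (V w)\<^sup>2) - (expect V)\<^sup>2 \<le> (1 - p)\<^sup>2 * overlap_sum p Q U"
proof -
  have "expect V = p * (1 - p) * (\<Sum>t\<in>Q. p ^ card (R t) * p ^ card (A t))"
    using A by (simp add: V_def expect_all_true)
  then have 1: "(expect V)\<^sup>2 = (1 - p)\<^sup>2 * (\<Sum>t\<in>Q. \<Sum>s\<in>Q. p\<^sup>2 * (p ^ card (R t) * p ^ card (R s) * (p ^ card (A t) * p ^ card (A s))))"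
    by (simp add: power2_eq_square sum_product sum_distrib_left mult_ac)
  have "(V w)\<^sup>2 = (1 - p)\<^sup>2 * (\<Sum>t\<in>Q. \<Sum>s\<in>Q. p\<^sup>2 * (p ^ card (R t) * p ^ card (R s) * all_true (A t \<union> A s) w))" for w
    by (simp add: V_def power2_eq_square sum_product sum_distrib_left mult_ac flip: all_true_mult)
  then have "expect (\<lambda>w. (V w)\<^sup>2)
      = (1 - p)\<^sup>2 * (\<Sum>t\<in>Q. \<Sum>s\<in>Q. p\<^sup>2 * (p ^ card (R t) * p ^ card (R s) * expect (all_true (A t \<union> A s))))"
    by simp
  also have "\<dots> = (1 - p)\<^sup>2 * (\<Sum>t\<in>Q. \<Sum>s\<in>Q. p\<^sup>2 * (p ^ card (R t) * p ^ card (R s) * p ^ card (A t \<union> A s)))"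
    using A by (simp add: expect_all_true)
  finally have "expect (\<lambda>w. (V w)\<^sup>2) - (expect V)\<^sup>2 = (1 - p)\<^sup>2 * (\<Sum>t\<in>Q. \<Sum>s\<in>Q.
      p\<^sup>2 * (p ^ card (R t) * p ^ card (R s) * p ^ card (A t \<union> A s))
      - p\<^sup>2 * (p ^ card (R t) * p ^ card (R s) * (p ^ card (A t) * p ^ card (A s))))"
    unfolding 1 by (simp only: sum_subtractf right_diff_distrib)
  also have "\<dots> \<le> (1 - p)\<^sup>2 * overlap_sum p Q U"
    unfolding overlap_sum_def
  proof (intro mult_left_mono sum_mono)
    fix t s assume t: "t \<in> Q" and s: "s \<in> Q"
    show "p\<^sup>2 * (p ^ card (R t) * p ^ card (R s) * p ^ card (A t \<union> A s))
      - p\<^sup>2 * (p ^ card (R t) * p ^ card (R s) * (p ^ card (A t) * p ^ card (A s)))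
      \<le> of_bool (U t \<inter> U s \<noteq> {}) * p ^ card (U t \<union> U s)" (is "?x - ?y \<le> _")
    proof (cases "A t \<inter> A s = {}")
      case True
      then have "?x = ?y" using fin_RA t s by (simp add: card_Un_disjoint power_add)
      then show ?thesis using p_pos by simp
    next
      case False
      then have "U t \<inter> U s \<noteq> {}" using U[OF t] U[OF s] by blast
      moreover have "?x \<le> p ^ card (U t \<union> U s)"
      proof -
        \<comment> \<open>The prefactor \<open>p\<^sup>2\<close> pays for adding the two edges
          \<open>K t\<close> and \<open>K s\<close> to the union.\<close>
        have "card (A t \<union> A s \<union> {K t, K s}) \<le> card (A t \<union> A s) + card {K t, K s}"
          by (rule card_Un_le)
        also have "\<dots> \<le> card (A t \<union> A s) + 2" by (simp add: card_insert_if)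
        finally have "p ^ (card (A t \<union> A s) + 2) \<le> p ^ card (A t \<union> A s \<union> {K t, K s})"
          using p_pos p_less_1 by (intro power_decreasing) auto
        then have "p ^ card (R t) * p ^ card (R s) * p ^ (card (A t \<union> A s) + 2)
            \<le> p ^ card (R t) * p ^ card (R s) * p ^ card (A t \<union> A s \<union> {K t, K s})"
          using p_pos by (intro mult_left_mono) auto
        also have "\<dots> \<le> p ^ card (U t \<union> U s)" by (rule weighted_union_le) fact+
        finally show ?thesis by (simp add: power_add power2_eq_square mult_ac)
      qed
      moreover have "0 \<le> ?y" using p_pos by simp
      ultimately show ?thesis by simp
    qed
  qed simp
  finally show ?thesis .
qed

text \<open>After expanding the square, each cross term is a centred pair, and the condition under
  which it survives forces the unions to meet.\<close>

lemma second_moment_le_overlap_sum: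
  "expect (\<lambda>w. (\<Sum>t\<in>Q. (of_bool (w (K t)) - p) * (p ^ card (R t) * all_true (A t) w))\<^sup>2)
    \<le> (1 - p) * overlap_sum p Q U"
proof -
  have "(\<Sum>t\<in>Q. (of_bool (w (K t)) - p) * (p ^ card (R t) * all_true (A t) w))\<^sup>2
      = (\<Sum>t\<in>Q. \<Sum>s\<in>Q. p ^ card (R t) * p ^ card (R s) *
           ((of_bool (w (K t)) - p) * ((of_bool (w (K s)) - p) * all_true (A t \<union> A s) w)))" for w
    by (simp add: power2_eq_square sum_product mult_ac flip: all_true_mult)
  then have "expect (\<lambda>w. (\<Sum>t\<in>Q. (of_bool (w (K t)) - p) * (p ^ card (R t) * all_true (A t) w))\<^sup>2)
      = (\<Sum>t\<in>Q. \<Sum>s\<in>Q. p ^ card (R t) * p ^ card (R s) *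
           expect (\<lambda>w. (of_bool (w (K t)) - p) * ((of_bool (w (K s)) - p) * all_true (A t \<union> A s) w)))"
    by simp
  also have "\<dots> \<le> (\<Sum>t\<in>Q. \<Sum>s\<in>Q. (1 - p) * (of_bool (U t \<inter> U s \<noteq> {}) * p ^ card (U t \<union> U s)))"
  proof (intro sum_mono)
    fix t s assume t: "t \<in> Q" and s: "s \<in> Q"
    let ?B = "A t \<union> A s" and ?c = "p ^ card (R t) * p ^ card (R s)"
    let ?conn = "K t = K s \<or> K t \<in> ?B \<and> K s \<in> ?B"
    have "?c * expect (\<lambda>w. (of_bool (w (K t)) - p) * ((of_bool (w (K s)) - p) * all_true ?B w))
        \<le> ?c * ((1 - p) * (of_bool ?conn * p ^ card (?B \<union> {K t, K s})))"
      by (intro mult_left_mono expect_centered_pair) (use A[OF t] A[OF s] K[OF t] K[OF s] p_pos in auto)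
    also have "\<dots> = (1 - p) * (of_bool ?conn * (?c * p ^ card (?B \<union> {K t, K s})))"
      by simp
    also have "\<dots> \<le> (1 - p) * (of_bool (U t \<inter> U s \<noteq> {}) * p ^ card (U t \<union> U s))"
    proof (intro mult_left_mono mult_mono weighted_union_le t s)
      \<comment> \<open>If \<open>K t\<close> and \<open>K s\<close> differ, then
        \<open>K t \<notin> A t\<close> leaves only \<open>K t \<in> A s\<close>.\<close>
      have "U t \<inter> U s \<noteq> {}" if ?conn
      proof (cases "K t = K s")
        case True
        then show ?thesis using K[OF t] K[OF s] by (metis IntI empty_iff)
      next
        case False
        then have "K t \<in> A s" using that K[OF t] by auto
        then show ?thesis using K[OF t] U[OF s] by blast
      qed
      then show "of_bool ?conn \<le> (of_bool (U t \<inter> U s \<noteq> {}) :: real)" by simp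
    qed (use p_pos p_less_1 in auto)
    finally show "?c * expect (\<lambda>w. (of_bool (w (K t)) - p) * ((of_bool (w (K s)) - p) * all_true ?B w))
        \<le> (1 - p) * (of_bool (U t \<inter> U s \<noteq> {}) * p ^ card (U t \<union> U s))" .
  qed
  also have "\<dots> = (1 - p) * overlap_sum p Q U"
    by (simp add: overlap_sum_def sum_distrib_left)
  finally show ?thesis .
qed

end

lemma overlap_sum_nonneg: "0 \<le> overlap_sum p Q U"
  using p_pos by (auto simp: overlap_sum_def intro!: sum_nonneg)

section \<open>Kolmogorov bound for a sum of indicators of edge sets\<close>

context
  fixes I :: "'i set" and T :: "'i \<Rightarrow> 'e set"
  assumes fin_I: "finite I" and T: "\<And>i. i \<in> I \<Longrightarrow> T i \<subseteq> E"
begin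

lemma expect_count: "expect (\<lambda>w. \<Sum>i\<in>I. all_true (T i) w) = (\<Sum>i\<in>I. p ^ card (T i))"
  using T by (simp add: expect_all_true)

lemma variance_count:
  "measure_pmf.variance M (\<lambda>w. \<Sum>i\<in>I. all_true (T i) w)
    = (\<Sum>i\<in>I. \<Sum>j\<in>I. p ^ card (T i \<union> T j) - p ^ (card (T i) + card (T j)))"
proof -
  have "expect (\<lambda>w. (\<Sum>i\<in>I. all_true (T i) w)\<^sup>2) = expect (\<lambda>w. \<Sum>i\<in>I. \<Sum>j\<in>I. all_true (T i \<union> T j) w)"
    by (simp add: power2_eq_square sum_product all_true_mult)
  also have "\<dots> = (\<Sum>i\<in>I. \<Sum>j\<in>I. p ^ card (T i \<union> T j))"
    using T by (simp add: expect_all_true)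
  finally show ?thesis
    by (subst measure_pmf.variance_eq)
      (simp_all add: expect_count power2_eq_square sum_product sum_subtractf power_add)
qed

text \<open>Telescoping each summand supplies the coefficients \<open>u k\<close>, and the products
  \<open>u k * disc_deriv k W\<close> expand over \<open>Q\<close>. Passing from first absolute to
  second moments, each of the two errors contributes twice the square root of its bound.\<close>

theorem count_kolmogorov_bound:
  defines "N \<equiv> \<lambda>w. \<Sum>i\<in>I. all_true (T i) w"
  defines "Q \<equiv> SIGMA k:E. {i \<in> I. k \<in> T i} \<times> {j \<in> I. k \<in> T j}"
  assumes var_pos: "0 < measure_pmf.variance M N"
  shows "\<bar>measure_pmf.prob M {w. (N w - expect N) / sqrt (measure_pmf.variance M N) \<le> z} - \<Phi> z\<bar>
    \<le> 4 * sqrt ((1 - p) * overlap_sum p Q (\<lambda>(k, i, j). T i \<union> T j)) / measure_pmf.variance M N"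
proof -
  define v where "v = measure_pmf.variance M N"
  define S where "S = overlap_sum p Q (\<lambda>(k, i, j). T i \<union> T j)"
  define J where "J k = {i \<in> I. k \<in> T i}" for k
  define W where "W w = (N w - expect N) / sqrt v" for w
  have v: "0 < v" using var_pos by (simp add: v_def)
  have S: "0 \<le> S" unfolding S_def by (rule overlap_sum_nonneg)
  have "\<forall>i\<in>I. \<exists>P. (\<forall>k\<in>T i. P k \<subseteq> T i - {k}) \<and>
      (\<forall>(p::real) w. all_true (T i) w - p ^ card (T i) =
         (\<Sum>k\<in>T i. (of_bool (w k) - p) * (p ^ card (T i - P k - {k}) * all_true (P k) w)))"
    using T finite_E by (intro ballI all_true_telescope) (auto intro: finite_subset)
  from bchoice[OF this] obtain P where
    P0: "\<forall>i\<in>I. (\<forall>k\<in>T i. P i k \<subseteq> T i - {k}) \<and>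
      (\<forall>(p::real) w. all_true (T i) w - p ^ card (T i) =
         (\<Sum>k\<in>T i. (of_bool (w k) - p) * (p ^ card (T i - P i k - {k}) * all_true (P i k) w)))"
    by (elim exE)
  have P: "P i k \<subseteq> T i - {k}" if "i \<in> I" "k \<in> T i" for i k
    using bspec[OF conjunct1[OF bspec[OF P0 that(1)]] that(2)] .
  have tele: "all_true (T i) w - p ^ card (T i) =
         (\<Sum>k\<in>T i. (of_bool (w k) - p) * (p ^ card (T i - P i k - {k}) * all_true (P i k) w))"
    if "i \<in> I" for i w
    using conjunct2[OF bspec[OF P0 that]] by blast
  define c where "c k i = p ^ card (T i - P i k - {k})" for k i
  \<comment> \<open>\<open>u k\<close> collects the telescoping coefficients of edge
    \<open>k\<close> from all copies through \<open>k\<close>.\<close>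
  define u where "u k w = (\<Sum>i\<in>J k. c k i * all_true (P i k) w) / sqrt v" for k w

  have repr: "W w = (\<Sum>k\<in>E. (of_bool (w k) - p) * u k w)" for w
  proof -
    have "N w - expect N = (\<Sum>i\<in>I. all_true (T i) w - p ^ card (T i))"
      unfolding N_def expect_count by (simp add: sum_subtractf)
    also have "\<dots> = (\<Sum>i\<in>I. \<Sum>k | k \<in> E \<and> k \<in> T i. (of_bool (w k) - p) * (c k i * all_true (P i k) w))"
    proof (rule sum.cong)
      fix i assume i: "i \<in> I"
      have "{k. k \<in> E \<and> k \<in> T i} = T i" using T[OF i] by auto
      then show "all_true (T i) w - p ^ card (T i)
          = (\<Sum>k | k \<in> E \<and> k \<in> T i. (of_bool (w k) - p) * (c k i * all_true (P i k) w))"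
        using tele[OF i] by (simp add: c_def)
    qed simp
    also have "\<dots> = (\<Sum>k\<in>E. \<Sum>i | i \<in> I \<and> k \<in> T i. (of_bool (w k) - p) * (c k i * all_true (P i k) w))"
      by (rule sum.swap_restrict[OF fin_I finite_E])
    finally show ?thesis
      by (simp add: W_def u_def J_def sum_divide_distrib sum_distrib_left)
  qed
  have indep: "u k (w(k := b)) = u k w" for k w b
  proof -
    have "all_true (P i k) (w(k := b)) = all_true (P i k) w" if "i \<in> J k" for i
      using P[of i k] that by (intro all_true_upd) (auto simp: J_def)
    then show ?thesis unfolding u_def by (intro arg_cong2[of _ _ _ _ "(/)"] sum.cong) auto
  qed
  have u_nonneg: "0 \<le> u k w" for k w
    using v p_pos by (auto simp: u_def c_def intro!: divide_nonneg_nonneg sum_nonneg)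
  have deriv: "disc_deriv k W w = (\<Sum>j\<in>J k. all_true (T j - {k}) w) / sqrt v" for k w
  proof -
    have "disc_deriv k W w = disc_deriv k N w / sqrt v"
      by (simp add: disc_deriv_def W_def diff_divide_distrib)
    also have "disc_deriv k N w = (\<Sum>j\<in>I. of_bool (k \<in> T j) * all_true (T j - {k}) w)"
      unfolding N_def by (simp add: disc_deriv_sum disc_deriv_all_true)
    also have "\<dots> = (\<Sum>j\<in>J k. all_true (T j - {k}) w)"
      unfolding J_def using fin_I by (intro sum.mono_neutral_cong_right) auto
    finally show ?thesis .
  qed
  have incr: "0 \<le> disc_deriv k W w" for k w
    using v by (auto simp: deriv intro!: divide_nonneg_nonneg sum_nonneg)

  \<comment> \<open>For \<open>(k, i, j)\<close>, \<open>R\<close> consists of the edges of copy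
    \<open>i\<close> after \<open>k\<close> in its telescoping, already replaced by
    \<open>p\<close>. \<open>A\<close> consists of the edges whose indicators remain: those of
    \<open>i\<close> before \<open>k\<close> and those of \<open>j\<close> other than
    \<open>k\<close>.\<close>
  define R where "R = (\<lambda>(k, i, j :: 'i). T i - P i k - {k})"
  define A where "A = (\<lambda>(k, i, j). P i k \<union> (T j - {k}))"
  have R: "R t \<subseteq> E" and A: "A t \<subseteq> E"
    and K: "fst t \<in> E \<and> fst t \<notin> A t \<and> fst t \<in> (case t of (k, i, j) \<Rightarrow> T i \<union> T j)"
    and U: "A t \<subseteq> (case t of (k, i, j) \<Rightarrow> T i \<union> T j)
      \<and> (case t of (k, i, j) \<Rightarrow> T i \<union> T j) \<subseteq> R t \<union> A t \<union> {fst t}"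
    if tQ: "t \<in> Q" for t
  proof -
    obtain k i j where t: "t = (k, i, j)" "i \<in> I" "j \<in> I" "k \<in> T i" "k \<in> T j" "k \<in> E"
      using tQ by (auto simp: Q_def)
    note * = P[OF t(2,4)] T[OF t(2)] T[OF t(3)]
    show "R t \<subseteq> E" "A t \<subseteq> E" using * by (auto simp: R_def A_def t(1))
    show "fst t \<in> E \<and> fst t \<notin> A t \<and> fst t \<in> (case t of (k, i, j) \<Rightarrow> T i \<union> T j)"
      using * t by (auto simp: A_def)
    show "A t \<subseteq> (case t of (k, i, j) \<Rightarrow> T i \<union> T j)
      \<and> (case t of (k, i, j) \<Rightarrow> T i \<union> T j) \<subseteq> R t \<union> A t \<union> {fst t}"
      using * t by (auto simp: A_def R_def)
  qed
  have uD: "(\<Sum>k\<in>E. g k * (u k w * disc_deriv k W w))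
      = (\<Sum>t\<in>Q. g (fst t) * (p ^ card (R t) * all_true (A t) w)) / v" for g w
  proof -
    have fin_J: "finite (J k)" for k using fin_I by (simp add: J_def)
    have "u k w * disc_deriv k W w = (\<Sum>i\<in>J k. \<Sum>j\<in>J k. c k i * all_true (P i k \<union> (T j - {k})) w) / v" for k
    proof -
      have "u k w * disc_deriv k W w
          = ((\<Sum>i\<in>J k. c k i * all_true (P i k) w) * (\<Sum>j\<in>J k. all_true (T j - {k}) w)) / v"
        using v by (simp add: u_def deriv)
      then show ?thesis by (simp only: sum_product mult.assoc all_true_mult)
    qed
    then have "(\<Sum>k\<in>E. g k * (u k w * disc_deriv k W w))
        = (\<Sum>k\<in>E. \<Sum>(i, j)\<in>J k \<times> J k. g k * (c k i * all_true (P i k \<union> (T j - {k})) w)) / v"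
      by (simp add: sum.cartesian_product sum_divide_distrib sum_distrib_left split_def)
    also have "(\<Sum>k\<in>E. \<Sum>(i, j)\<in>J k \<times> J k. g k * (c k i * all_true (P i k \<union> (T j - {k})) w))
        = (\<Sum>t\<in>Q. g (fst t) * (p ^ card (R t) * all_true (A t) w))"
      unfolding Q_def J_def[symmetric]
      by (subst sum.Sigma) (auto simp: finite_E fin_J R_def A_def c_def intro!: sum.cong)
    finally show ?thesis .
  qed

  define V where "V w = p * (1 - p) * (\<Sum>k\<in>E. u k w * disc_deriv k W w)" for w
  define V' where "V' w = p * (1 - p) * (\<Sum>t\<in>Q. p ^ card (R t) * all_true (A t) w)" for w
  define Y where "Y w = (\<Sum>k\<in>E. (of_bool (w k) - p) * (u k w * disc_deriv k W w))" for w
  define Y' where "Y' w = (\<Sum>t\<in>Q. (of_bool (w (fst t)) - p) * (p ^ card (R t) * all_true (A t) w))" for w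
  have V_eq: "V w = V' w / v" for w
    unfolding V_def V'_def using uD[of "\<lambda>_. 1" w] by simp
  have Y_eq: "Y w = Y' w / v" for w
    unfolding Y_def Y'_def by (rule uD)
  have "expect (\<lambda>w. (V' w)\<^sup>2) - (expect V')\<^sup>2 \<le> (1 - p)\<^sup>2 * S"
    unfolding V'_def S_def
    by (rule variance_le_overlap_sum[where K = fst]) (use R A K U in blast)+
  then have V': "(expect (\<lambda>w. (V' w)\<^sup>2) - (expect V')\<^sup>2) / v\<^sup>2 \<le> (1 - p)\<^sup>2 * S / v\<^sup>2"
    using v by (intro divide_right_mono) auto
  have "expect (\<lambda>w. (Y' w)\<^sup>2) \<le> (1 - p) * S"
    unfolding Y'_def S_def
    by (rule second_moment_le_overlap_sum[where K = fst]) (use R A K U in blast)+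
  then have Y': "expect (\<lambda>w. (Y' w)\<^sup>2) / v\<^sup>2 \<le> (1 - p) * S / v\<^sup>2"
    using v by (intro divide_right_mono) auto

  \<comment> \<open>The kernel \<open>V\<close> has mean equal to the variance of \<open>W\<close>,
    that is 1, so the mean square of \<open>1 - V\<close> is the variance of
    \<open>V\<close>.\<close>
  have "expect V = expect (\<lambda>w. W w * W w)"
    unfolding V_def using expect_mult_representation[OF indep repr, where F = W]
    by (simp add: sum_distrib_left)
  also have "\<dots> = expect (\<lambda>w. (N w - expect N)\<^sup>2 / v)"
    using v by (simp add: W_def power2_eq_square)
  also have "\<dots> = 1" using v by (simp add: v_def)
  finally have EV: "expect V = 1" .
  have "expect (\<lambda>w. (1 - V w)\<^sup>2) = 1 - 2 * expect V + expect (\<lambda>w. (V w)\<^sup>2)"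
    by (simp add: power2_diff)
  also have "\<dots> = expect (\<lambda>w. (V w)\<^sup>2) - (expect V)\<^sup>2" by (simp add: EV)
  also have "\<dots> = (expect (\<lambda>w. (V' w)\<^sup>2) - (expect V')\<^sup>2) / v\<^sup>2"
    unfolding V_eq by (simp add: power_divide diff_divide_distrib)
  also have "\<dots> \<le> (1 - p)\<^sup>2 * S / v\<^sup>2" by (rule V')
  \<comment> \<open>One factor \<open>1 - p\<close> is given away so that both errors obey the same
    bound.\<close>
  also have "\<dots> \<le> (1 - p) * S / v\<^sup>2"
    using p_pos p_less_1 S by (intro divide_right_mono mult_right_mono) (auto simp: power2_eq_square mult_left_le)
  finally have "sqrt (expect (\<lambda>w. (1 - V w)\<^sup>2)) \<le> sqrt ((1 - p) * S / v\<^sup>2)" by simp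
  then have 1: "expect (\<lambda>w. \<bar>1 - V w\<bar>) \<le> sqrt ((1 - p) * S) / v"
    using expect_abs_le_sqrt[of "\<lambda>w. 1 - V w"] v by (simp add: real_sqrt_divide)
  have "expect (\<lambda>w. (Y w)\<^sup>2) = expect (\<lambda>w. (Y' w)\<^sup>2) / v\<^sup>2"
    unfolding Y_eq by (simp add: power_divide)
  then have "sqrt (expect (\<lambda>w. (Y w)\<^sup>2)) \<le> sqrt ((1 - p) * S / v\<^sup>2)" using Y' by simp
  then have 2: "expect (\<lambda>w. \<bar>Y w\<bar>) \<le> sqrt ((1 - p) * S) / v"
    using expect_abs_le_sqrt[of Y] v by (simp add: real_sqrt_divide)
  have "\<bar>measure_pmf.prob M {w. W w \<le> z} - \<Phi> z\<bar>
      \<le> 2 * expect (\<lambda>w. \<bar>1 - V w\<bar>) + 2 * expect (\<lambda>w. \<bar>Y w\<bar>)"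
    unfolding V_def Y_def by (rule stein_kolmogorov_bound[OF indep u_nonneg incr repr])
  also have "\<dots> \<le> 4 * sqrt ((1 - p) * S) / v" using 1 2 by simp
  finally show ?thesis by (simp add: W_def v_def S_def)
qed

end

end

section \<open>Sums over attached quadruples\<close>

text \<open>Each pair is counted once for every common element, hence at most \<open>r\<close> times
  and only if the two sets meet.\<close>

lemma sum_shared_element_le:
  fixes F :: "'i \<Rightarrow> 'i \<Rightarrow> real"
  assumes fin_E: "finite E" and fin_I: "finite I"
    and T: "\<And>i. i \<in> I \<Longrightarrow> T i \<subseteq> E" and r: "\<And>i. i \<in> I \<Longrightarrow> card (T i) \<le> r"
    and F: "\<And>i j. 0 \<le> F i j"
  shows "(\<Sum>(k, i, j)\<in>(SIGMA k:E. {i \<in> I. k \<in> T i} \<times> {j \<in> I. k \<in> T j}). F i j)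
    \<le> r * (\<Sum>i\<in>I. \<Sum>j\<in>I. of_bool (T i \<inter> T j \<noteq> {}) * F i j)"
proof -
  have fin_T: "finite (T i)" if "i \<in> I" for i using T[OF that] fin_E by (rule finite_subset)
  have "(\<Sum>(k, i, j)\<in>(SIGMA k:E. {i \<in> I. k \<in> T i} \<times> {j \<in> I. k \<in> T j}). F i j)
      = (\<Sum>(x, k)\<in>(SIGMA x:I \<times> I. T (fst x) \<inter> T (snd x)). F (fst x) (snd x))"
    by (rule sum.reindex_bij_witness[where i = "\<lambda>((i, j), k). (k, i, j)" and j = "\<lambda>(k, i, j). ((i, j), k)"])
      (auto dest: subsetD[OF T])
  also have "\<dots> = (\<Sum>x\<in>I \<times> I. \<Sum>k\<in>T (fst x) \<inter> T (snd x). F (fst x) (snd x))"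
    by (rule sum.Sigma[symmetric]) (use fin_I fin_T in auto)
  also have "\<dots> \<le> (\<Sum>x\<in>I \<times> I. r * (of_bool (T (fst x) \<inter> T (snd x) \<noteq> {}) * F (fst x) (snd x)))"
  proof (rule sum_mono)
    fix x assume x: "x \<in> I \<times> I"
    have "card (T (fst x) \<inter> T (snd x)) \<le> card (T (fst x))"
      using x by (intro card_mono fin_T) auto
    also have "\<dots> \<le> r" using x by (intro r) auto
    finally show "(\<Sum>k\<in>T (fst x) \<inter> T (snd x). F (fst x) (snd x))
        \<le> r * (of_bool (T (fst x) \<inter> T (snd x) \<noteq> {}) * F (fst x) (snd x))"
      using F by (cases "T (fst x) \<inter> T (snd x) = {}") (auto intro!: mult_right_mono)
  qed
  also have "\<dots> = r * (\<Sum>i\<in>I. \<Sum>j\<in>I. of_bool (T i \<inter> T j \<noteq> {}) * F i j)"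
    by (simp add: sum_distrib_left sum.cartesian_product split_def)
  finally show ?thesis .
qed

text \<open>The first copy contributes \<open>card I * p ^ r\<close> in total, and each of the three
  copies attached to it costs a factor \<open>L\<close>. The two chosen common elements give
  \<open>r\<close> each, and the factor 2 covers the order of the last two attachments. The largest
  set receiving a copy is a union of three copies, whence \<open>3 * r\<close>.\<close>

lemma overlap_sum_le_of_attachment:
  fixes p L :: real
  assumes fin_E: "finite E" and fin_I: "finite I"
    and T: "\<And>i. i \<in> I \<Longrightarrow> T i \<subseteq> E" and r: "\<And>i. i \<in> I \<Longrightarrow> card (T i) = r"
    and p: "0 \<le> p" and L: "0 \<le> L"
    and attach: "\<And>\<Gamma>. \<Gamma> \<subseteq> E \<Longrightarrow> card \<Gamma> \<le> 3 * r \<Longrightarrow>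
      (\<Sum>i\<in>I. of_bool (T i \<inter> \<Gamma> \<noteq> {}) * p ^ card (\<Gamma> \<union> T i)) \<le> L * p ^ card \<Gamma>"
  shows "overlap_sum p (SIGMA k:E. {i \<in> I. k \<in> T i} \<times> {j \<in> I. k \<in> T j}) (\<lambda>(k, i, j). T i \<union> T j)
    \<le> 2 * (real r)\<^sup>2 * L ^ 3 * card I * p ^ r"
proof -
  define Q where "Q = (SIGMA k:E. {i \<in> I. k \<in> T i} \<times> {j \<in> I. k \<in> T j})"
  define c where "c i j = (of_bool (T i \<inter> T j \<noteq> {}) :: real)" for i j
  define F where "F i j i' j' = of_bool ((T i \<union> T j) \<inter> (T i' \<union> T j') \<noteq> {}) * p ^ card (T i \<union> T j \<union> (T i' \<union> T j'))" for i j i' j'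
  have F: "0 \<le> F i j i' j'" for i j i' j' using p by (simp add: F_def)
  \<comment> \<open>Two successive attachments: the second copy may meet \<open>\<Gamma>\<close> or
    only the first new copy.\<close>
  have two: "(\<Sum>i'\<in>I. of_bool (T i' \<inter> \<Gamma> \<noteq> {}) * (\<Sum>j'\<in>I. of_bool (T j' \<inter> (\<Gamma> \<union> T i') \<noteq> {}) * p ^ card (\<Gamma> \<union> T i' \<union> T j')))
      \<le> L\<^sup>2 * p ^ card \<Gamma>" if \<Gamma>: "\<Gamma> \<subseteq> E" "card \<Gamma> \<le> 2 * r" for \<Gamma>
  proof -
    have "(\<Sum>i'\<in>I. of_bool (T i' \<inter> \<Gamma> \<noteq> {}) * (\<Sum>j'\<in>I. of_bool (T j' \<inter> (\<Gamma> \<union> T i') \<noteq> {}) * p ^ card (\<Gamma> \<union> T i' \<union> T j')))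
      \<le> (\<Sum>i'\<in>I. of_bool (T i' \<inter> \<Gamma> \<noteq> {}) * (L * p ^ card (\<Gamma> \<union> T i')))"
    proof (intro sum_mono mult_left_mono attach)
      fix i assume i: "i \<in> I"
      show "\<Gamma> \<union> T i \<subseteq> E" using \<Gamma> T[OF i] by auto
      show "card (\<Gamma> \<union> T i) \<le> 3 * r" using card_Un_le[of \<Gamma> "T i"] r[OF i] \<Gamma> by linarith
    qed simp
    also have "\<dots> = L * (\<Sum>i'\<in>I. of_bool (T i' \<inter> \<Gamma> \<noteq> {}) * p ^ card (\<Gamma> \<union> T i'))"
      by (simp add: sum_distrib_left mult_ac)
    also have "\<dots> \<le> L * (L * p ^ card \<Gamma>)"
      using \<Gamma> L by (intro mult_left_mono attach) auto
    finally show ?thesis by (simp add: power2_eq_square)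
  qed
  have inner: "(\<Sum>i'\<in>I. \<Sum>j'\<in>I. c i' j' * F i j i' j') \<le> 2 * L\<^sup>2 * p ^ card (T i \<union> T j)"
    if i: "i \<in> I" and j: "j \<in> I" for i j
  proof -
    define \<Gamma> where "\<Gamma> = T i \<union> T j"
    define G where "G i' j' = of_bool (T i' \<inter> \<Gamma> \<noteq> {}) * (of_bool (T j' \<inter> (\<Gamma> \<union> T i') \<noteq> {}) * p ^ card (\<Gamma> \<union> T i' \<union> T j'))" for i' j'
    have \<Gamma>: "\<Gamma> \<subseteq> E" "card \<Gamma> \<le> 2 * r"
      using T[OF i] T[OF j] card_Un_le[of "T i" "T j"] r[OF i] r[OF j] by (auto simp: \<Gamma>_def)
    \<comment> \<open>One of the two new copies meets \<open>\<Gamma>\<close>; the other is attached after it.\<close>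
    have "c i' j' * F i j i' j' \<le> G i' j' + G j' i'" for i' j'
    proof -
      have "\<Gamma> \<union> (T i' \<union> T j') = \<Gamma> \<union> T i' \<union> T j'" "\<Gamma> \<union> (T i' \<union> T j') = \<Gamma> \<union> T j' \<union> T i'" by auto
      then show ?thesis
        using p unfolding c_def F_def G_def \<Gamma>_def[symmetric]
        by (cases "T i' \<inter> T j' = {}"; cases "T i' \<inter> \<Gamma> = {}"; cases "T j' \<inter> \<Gamma> = {}")
          (auto simp: Int_Un_distrib Int_commute)
    qed
    then have "(\<Sum>i'\<in>I. \<Sum>j'\<in>I. c i' j' * F i j i' j') \<le> (\<Sum>i'\<in>I. \<Sum>j'\<in>I. G i' j' + G j' i')"
      by (intro sum_mono)
    also have "\<dots> = (\<Sum>i'\<in>I. \<Sum>j'\<in>I. G i' j') + (\<Sum>i'\<in>I. \<Sum>j'\<in>I. G j' i')"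
      by (simp add: sum.distrib)
    also have "(\<Sum>i'\<in>I. \<Sum>j'\<in>I. G j' i') = (\<Sum>i'\<in>I. \<Sum>j'\<in>I. G i' j')"
      by (rule sum.swap)
    finally have "(\<Sum>i'\<in>I. \<Sum>j'\<in>I. c i' j' * F i j i' j') \<le> 2 * (\<Sum>i'\<in>I. \<Sum>j'\<in>I. G i' j')"
      by simp
    also have "\<dots> \<le> 2 * (L\<^sup>2 * p ^ card \<Gamma>)"
      using two[OF \<Gamma>] by (simp add: G_def flip: sum_distrib_left)
    finally show ?thesis by (simp add: \<Gamma>_def)
  qed
  have sum_Q: "(\<Sum>(k, i, j)\<in>Q. H i j) \<le> r * (\<Sum>i\<in>I. \<Sum>j\<in>I. c i j * H i j)"
    if "\<And>i j. 0 \<le> H i j" for H :: "_ \<Rightarrow> _ \<Rightarrow> real"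
    unfolding Q_def c_def by (rule sum_shared_element_le) (use assms that in auto)
  have "overlap_sum p Q (\<lambda>(k, i, j). T i \<union> T j) = (\<Sum>(k, i, j)\<in>Q. \<Sum>(k', i', j')\<in>Q. F i j i' j')"
    by (simp add: overlap_sum_def F_def split_def)
  also have "\<dots> \<le> r * (\<Sum>i\<in>I. \<Sum>j\<in>I. c i j * (\<Sum>(k', i', j')\<in>Q. F i j i' j'))"
    by (rule sum_Q) (auto intro!: sum_nonneg F)
  also have "\<dots> \<le> r * (\<Sum>i\<in>I. \<Sum>j\<in>I. c i j * (r * (2 * L\<^sup>2 * p ^ card (T i \<union> T j))))"
  proof (intro mult_left_mono sum_mono)
    fix i j assume ij: "i \<in> I" "j \<in> I"
    have "(\<Sum>(k', i', j')\<in>Q. F i j i' j') \<le> r * (\<Sum>i'\<in>I. \<Sum>j'\<in>I. c i' j' * F i j i' j')"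
      by (rule sum_Q[OF F])
    also have "\<dots> \<le> r * (2 * L\<^sup>2 * p ^ card (T i \<union> T j))"
      by (intro mult_left_mono inner ij) auto
    finally show "(\<Sum>(k', i', j')\<in>Q. F i j i' j') \<le> r * (2 * L\<^sup>2 * p ^ card (T i \<union> T j))" .
  qed (auto simp: c_def)
  also have "\<dots> = 2 * (real r)\<^sup>2 * L\<^sup>2 * (\<Sum>i\<in>I. \<Sum>j\<in>I. of_bool (T j \<inter> T i \<noteq> {}) * p ^ card (T i \<union> T j))"
    by (simp add: c_def sum_distrib_left power2_eq_square mult_ac Int_commute)
  \<comment> \<open>The remaining double sum is one more attachment, of copy \<open>j\<close> to
    copy \<open>i\<close>.\<close>
  also have "\<dots> \<le> 2 * (real r)\<^sup>2 * L\<^sup>2 * (\<Sum>i\<in>I. L * p ^ card (T i))"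
    using T r by (intro mult_left_mono sum_mono attach) auto
  also have "\<dots> = 2 * (real r)\<^sup>2 * L ^ 3 * card I * p ^ r"
    using r by (simp add: power2_eq_square power3_eq_cube)
  finally show ?thesis by (simp add: Q_def)
qed

text \<open>Cauchy-Schwarz for the fibre sizes of \<open>\<rho>\<close>, whose squares add up to the
  number of pairs in a common fibre. It will count pairs of embeddings that agree on a
  subgraph.\<close>

lemma card_squared_le_card_fibre_pairs:
  assumes fin_X: "finite X" and fin_D: "finite D" and sub: "\<rho> ` X \<subseteq> D"
  shows "(real (card X))\<^sup>2 \<le> real (card D) * real (card {(f, g) \<in> X \<times> X. \<rho> f = \<rho> g})"
proof -
  define c where "c d = card {f \<in> X. \<rho> f = d}" for d
  have "card X = (\<Sum>d\<in>D. c d)"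
    using sum.group[OF fin_X fin_D sub, of "\<lambda>_. 1 :: nat"] by (simp add: c_def)
  then have "(real (card X))\<^sup>2 = (\<Sum>d\<in>D. real (c d))\<^sup>2" by simp
  also have "\<dots> \<le> card D * (\<Sum>d\<in>D. (real (c d))\<^sup>2)"
    using Cauchy_Schwarz_ineq_sum[of "\<lambda>_. 1" "\<lambda>d. real (c d)" D] by simp
  also have "(\<Sum>d\<in>D. (real (c d))\<^sup>2) = real (\<Sum>d\<in>D. card ({f \<in> X. \<rho> f = d} \<times> {f \<in> X. \<rho> f = d}))"
    by (simp add: c_def card_cartesian_product power2_eq_square)
  also have "(\<Sum>d\<in>D. card ({f \<in> X. \<rho> f = d} \<times> {f \<in> X. \<rho> f = d}))
      = card (\<Union>d\<in>D. {f \<in> X. \<rho> f = d} \<times> {f \<in> X. \<rho> f = d})"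
    by (rule card_UN_disjoint[symmetric]) (use fin_X fin_D in auto)
  also have "(\<Union>d\<in>D. {f \<in> X. \<rho> f = d} \<times> {f \<in> X. \<rho> f = d}) = {(f, g) \<in> X \<times> X. \<rho> f = \<rho> g}"
    using sub by auto
  finally show ?thesis .
qed

section \<open>Copies and embeddings\<close>

definition edge_image :: "('a \<Rightarrow> 'b) \<Rightarrow> 'a set set \<Rightarrow> 'b set set" where
  "edge_image f F = (\<lambda>e. f ` e) ` F"

text \<open>Embeddings into the complete graph, so edges enter only later through
  \<open>edge_image\<close>. Extensionality makes each embedding a single function.\<close>

definition embeddings :: "'a ugraph \<Rightarrow> nat \<Rightarrow> ('a \<Rightarrow> nat) set" where
  "embeddings G n = {f \<in> verts G \<rightarrow>\<^sub>E {..<n}. inj_on f (verts G)}"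

definition isos :: "'a ugraph \<Rightarrow> 'b ugraph \<Rightarrow> ('a \<Rightarrow> 'b) set" where
  "isos G H = {f \<in> extensional (verts G). bij_betw f (verts G) (verts H) \<and> edge_image f (edges G) = edges H}"

lemma finite_complete_edges: "finite V \<Longrightarrow> finite (complete_edges V)"
  by (rule finite_subset[of _ "Pow V"]) (auto simp: complete_edges_def)

lemma complete_edgesE:
  assumes "e \<in> complete_edges V"
  obtains x y where "e = {x, y}" "x \<noteq> y" "x \<in> V" "y \<in> V"
  using assms by (auto simp: complete_edges_def card_2_iff)

lemma edge_image_complete_edges:
  assumes "inj_on f V" "f ` V \<subseteq> W" "F \<subseteq> complete_edges V"
  shows "edge_image f F \<subseteq> complete_edges W"
  unfolding edge_image_def complete_edges_def
proof clarify
  fix e assume "e \<in> F"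
  then have e: "e \<subseteq> V" "card e = 2" using assms(3) by (auto simp: complete_edges_def)
  then have "card (f ` e) = 2" using card_image[OF inj_on_subset[OF assms(1) e(1)]] by simp
  then show "f ` e \<subseteq> W \<and> card (f ` e) = 2" using assms(2) e(1) by auto
qed

lemma inj_on_edge_image:
  assumes "inj_on f V" "F \<subseteq> complete_edges V"
  shows "inj_on ((`) f) F"
proof (rule inj_onI)
  fix e e' assume "e \<in> F" "e' \<in> F" "f ` e = f ` e'"
  moreover from this have "e \<subseteq> V" "e' \<subseteq> V" using assms(2) by (auto simp: complete_edges_def)
  ultimately show "e = e'" using inj_on_image_eq_iff[OF assms(1)] by blast
qed

lemma card_edge_image:
  assumes "inj_on f V" "F \<subseteq> complete_edges V"
  shows "card (edge_image f F) = card F"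
  unfolding edge_image_def by (rule card_image[OF inj_on_edge_image[OF assms]])

text \<open>The relation runs from \<open>H\<close> to \<open>G\<close>, so the witness is the
  inverse of \<open>f\<close>.\<close>

lemma isos_imp_isomorphic:
  assumes G: "finite_simple_graph G" and f: "f \<in> isos G H"
  shows "isomorphic H G"
proof -
  have bij: "bij_betw f (verts G) (verts H)" and im: "edge_image f (edges G) = edges H"
    using f by (auto simp: isos_def)
  define h where "h = inv_into (verts G) f"
  have h: "bij_betw h (verts H) (verts G)"
    unfolding h_def by (rule bij_betw_inv_into[OF bij])
  have fh: "f (h u) = u" if "u \<in> verts H" for u
    using that bij by (auto simp: h_def bij_betw_def intro: f_inv_into_f)
  have hf: "h (f x) = x" if "x \<in> verts G" for x
    using that bij by (auto simp: h_def bij_betw_def)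
  have "{u, v} \<in> edges H \<longleftrightarrow> {h u, h v} \<in> edges G" if uv: "u \<in> verts H" "v \<in> verts H" for u v
  proof
    assume "{u, v} \<in> edges H"
    then obtain e where e: "e \<in> edges G" "{u, v} = f ` e"
      unfolding im[symmetric] edge_image_def by blast
    have "e \<subseteq> verts G" using G e(1) by (auto simp: finite_simple_graph_def complete_edges_def)
    then have "h ` f ` e = e" using hf by (force simp: image_image)
    then have "{h u, h v} = e" by (simp flip: e(2))
    then show "{h u, h v} \<in> edges G" using e(1) by simp
  next
    assume "{h u, h v} \<in> edges G"
    then have "f ` {h u, h v} \<in> edges H" unfolding im[symmetric] edge_image_def by blast
    then show "{u, v} \<in> edges H" by (simp add: fh uv)
  qed
  then show ?thesis unfolding isomorphic_def using h by blast
qed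

lemma isomorphic_imp_isos:
  assumes G: "finite_simple_graph G" and H: "finite_simple_graph H" and "isomorphic H G"
  shows "isos G H \<noteq> {}"
proof -
  obtain h where h: "bij_betw h (verts H) (verts G)"
    and hE: "\<And>u v. u \<in> verts H \<Longrightarrow> v \<in> verts H \<Longrightarrow> {u, v} \<in> edges H \<longleftrightarrow> {h u, h v} \<in> edges G"
    using assms(3) unfolding isomorphic_def by blast
  define f where "f = restrict (inv_into (verts H) h) (verts G)"
  have bij: "bij_betw f (verts G) (verts H)"
    using bij_betw_inv_into[OF h] by (simp add: f_def)
  have fV: "f x \<in> verts H" "h (f x) = x" if "x \<in> verts G" for x
    using that h bij by (auto simp: f_def bij_betw_def f_inv_into_f inv_into_into)
  have hV: "h u \<in> verts G" "f (h u) = u" if "u \<in> verts H" for u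
    using that h by (auto simp: f_def bij_betw_def)
  have "edge_image f (edges G) = edges H"
  proof (intro equalityI subsetI)
    fix e' assume "e' \<in> edge_image f (edges G)"
    then obtain e where e: "e \<in> edges G" "e' = f ` e" by (auto simp: edge_image_def)
    obtain x y where xy: "e = {x, y}" "x \<in> verts G" "y \<in> verts G"
      using e(1) G by (auto simp: finite_simple_graph_def elim!: complete_edgesE dest!: subsetD)
    have "{f x, f y} \<in> edges H"
      using hE[of "f x" "f y"] fV[OF xy(2)] fV[OF xy(3)] e(1) xy(1) by simp
    then show "e' \<in> edges H" using e(2) xy(1) by simp
  next
    fix e' assume e': "e' \<in> edges H"
    obtain u v where uv: "e' = {u, v}" "u \<in> verts H" "v \<in> verts H"
      using e' H by (auto simp: finite_simple_graph_def elim!: complete_edgesE dest!: subsetD)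
    have "{h u, h v} \<in> edges G" using hE[of u v] uv e' by simp
    moreover have "e' = f ` {h u, h v}" using uv hV by simp
    ultimately show "e' \<in> edge_image f (edges G)" unfolding edge_image_def by blast
  qed
  then have "f \<in> isos G H" using bij by (simp add: isos_def f_def)
  then show ?thesis by blast
qed

lemma edge_image_comp_restrict:
  assumes "F \<subseteq> complete_edges V"
  shows "edge_image (restrict (g \<circ> f) V) F = edge_image g (edge_image f F)"
proof -
  have "restrict (g \<circ> f) V ` e = g ` f ` e" if "e \<in> F" for e
    using that assms by (force simp: complete_edges_def)
  then show ?thesis by (auto simp: edge_image_def image_image)
qed

lemma edge_image_cong:
  assumes "F \<subseteq> complete_edges V" "\<And>x. x \<in> V \<Longrightarrow> f x = g x"
  shows "edge_image f F = edge_image g F"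
proof -
  have "f ` e = g ` e" if "e \<in> F" for e
    using that assms by (intro image_cong) (auto simp: complete_edges_def)
  then show ?thesis by (simp add: edge_image_def)
qed

text \<open>Composition with the fixed isomorphism \<open>f0\<close> is a bijection from the
  automorphisms of \<open>G\<close> onto \<open>isos G H\<close>.\<close>

lemma card_isos_eq_card_automorphisms:
  assumes G: "finite_simple_graph G" and f0: "f0 \<in> isos G H"
  shows "card (isos G H) = card (isos G G)"
proof -
  let ?V = "verts G"
  have E: "edges G \<subseteq> complete_edges ?V" using G by (simp add: finite_simple_graph_def)
  have b0: "bij_betw f0 ?V (verts H)" and e0: "edge_image f0 (edges G) = edges H"
    using f0 by (auto simp: isos_def)
  define g where "g = inv_into ?V f0"
  have bg: "bij_betw g (verts H) ?V" unfolding g_def by (rule bij_betw_inv_into[OF b0])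
  have gf: "g (f0 x) = x" if "x \<in> ?V" for x using that b0 by (auto simp: g_def bij_betw_def)
  have fg: "f0 (g u) = u" if "u \<in> verts H" for u
    using that b0 by (auto simp: g_def bij_betw_def f_inv_into_f)
  have "bij_betw (\<lambda>s. restrict (f0 \<circ> s) ?V) (isos G G) (isos G H)"
  proof (rule bij_betw_byWitness[where f' = "\<lambda>f. restrict (g \<circ> f) ?V"])
    show "\<forall>s\<in>isos G G. restrict (g \<circ> restrict (f0 \<circ> s) ?V) ?V = s"
      by (auto simp: isos_def extensional_def fun_eq_iff gf bij_betwE)
    show "\<forall>f\<in>isos G H. restrict (f0 \<circ> restrict (g \<circ> f) ?V) ?V = f"
      by (auto simp: isos_def extensional_def fun_eq_iff fg bij_betwE)
    show "(\<lambda>s. restrict (f0 \<circ> s) ?V) ` isos G G \<subseteq> isos G H"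
      using b0 e0 E by (auto simp: isos_def edge_image_comp_restrict intro: bij_betw_trans)
    have "edge_image g (edges H) = edge_image (restrict (g \<circ> f0) ?V) (edges G)"
      by (simp add: edge_image_comp_restrict[OF E] e0)
    also have "\<dots> = edge_image id (edges G)"
      by (rule edge_image_cong[OF E]) (simp add: gf)
    finally have "edge_image g (edges H) = edges G" by (simp add: edge_image_def)
    then show "(\<lambda>f. restrict (g \<circ> f) ?V) ` isos G H \<subseteq> isos G G"
      using bg E by (auto simp: isos_def edge_image_comp_restrict intro: bij_betw_trans)
  qed
  then show ?thesis by (rule bij_betw_same_card[symmetric])
qed

lemma finite_embeddings: "finite (verts G) \<Longrightarrow> finite (embeddings G n)"
  by (rule finite_subset[of _ "verts G \<rightarrow>\<^sub>E {..<n}"]) (auto simp: embeddings_def finite_PiE)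

lemma finite_automorphisms:
  assumes "finite (verts G)"
  shows "finite (isos G G)"
proof (rule finite_subset)
  show "isos G G \<subseteq> verts G \<rightarrow>\<^sub>E verts G" by (auto simp: isos_def PiE_def bij_betwE)
qed (simp add: finite_PiE assms)

lemma card_automorphisms_pos:
  assumes "finite_simple_graph G"
  shows "0 < card (isos G G)"
proof -
  have E: "edges G \<subseteq> complete_edges (verts G)" and fin: "finite (verts G)"
    using assms by (auto simp: finite_simple_graph_def)
  have "restrict id (verts G) \<in> isos G G"
    using edge_image_cong[OF E, of "restrict id (verts G)" id]
    by (auto simp: isos_def edge_image_def)
  then show ?thesis using finite_automorphisms[OF fin] card_gt_0_iff by blast
qed

text \<open>Double counting: send an embedding with all image edges retained to its image graph. The
  fibre over a copy \<open>H\<close> is \<open>isos G H\<close>, which has as many elements as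
  \<open>G\<close> has automorphisms.\<close>

lemma card_automorphisms_mult_subgraph_count:
  fixes n :: nat
  assumes G: "finite_simple_graph G"
  defines "host \<equiv> \<lambda>w. ({..<n}, {e \<in> complete_edges {..<n}. w e})"
  shows "card (isos G G) * subgraph_count G (host w)
    = (\<Sum>f\<in>embeddings G n. all_true (edge_image f (edges G)) w)"
proof -
  let ?V = "verts G" and ?T = "\<lambda>f. edge_image f (edges G)"
  have E: "edges G \<subseteq> complete_edges ?V" and fin: "finite ?V"
    using G by (auto simp: finite_simple_graph_def)
  define X where "X = {f \<in> embeddings G n. \<forall>e\<in>?T f. w e}"
  define C where "C = {H. subgraph H (host w) \<and> isomorphic H G}"
  define \<Theta> where "\<Theta> f = (f ` ?V, ?T f)" for f :: "'a \<Rightarrow> nat"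
  have fin_X: "finite X" using finite_embeddings[OF fin, of n] by (simp add: X_def)
  have fin_C: "finite C"
  proof (rule finite_subset)
    show "C \<subseteq> Pow {..<n} \<times> Pow (complete_edges {..<n})"
      by (auto simp: C_def subgraph_def host_def)
    show "finite (Pow {..<n} \<times> Pow (complete_edges {..<n}))"
      by (simp add: finite_complete_edges)
  qed
  have iso: "f \<in> isos G (\<Theta> f)" if "f \<in> X" for f
    using that by (auto simp: X_def embeddings_def isos_def \<Theta>_def bij_betw_def PiE_def)
  have "\<Theta> ` X \<subseteq> C"
  proof (rule image_subsetI)
    fix f assume f: "f \<in> X"
    then have inj: "inj_on f ?V" and sub: "f ` ?V \<subseteq> {..<n}" and w: "\<forall>e\<in>?T f. w e"
      by (auto simp: X_def embeddings_def)
    have "subgraph (\<Theta> f) (host w)"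
      using edge_image_complete_edges[OF inj _ E, of "f ` ?V"] edge_image_complete_edges[OF inj sub E] fin w sub
      by (auto simp: subgraph_def \<Theta>_def host_def finite_simple_graph_def)
    then show "\<Theta> f \<in> C" using isos_imp_isomorphic[OF G iso[OF f]] by (simp add: C_def)
  qed
  then have "card X = (\<Sum>H\<in>C. card {f \<in> X. \<Theta> f = H})"
    using sum.group[OF fin_X fin_C, of \<Theta> "\<lambda>_. 1 :: nat"] by simp
  also have "\<dots> = (\<Sum>H\<in>C. card (isos G G))"
  proof (rule sum.cong)
    fix H assume "H \<in> C"
    then have H: "subgraph H (host w)" "isomorphic H G" by (auto simp: C_def)
    have "{f \<in> X. \<Theta> f = H} = isos G H"
    proof (intro equalityI subsetI)
      fix f assume "f \<in> isos G H"
      then have "f \<in> extensional ?V" "inj_on f ?V" and *: "f ` ?V = verts H" "?T f = edges H"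
        by (auto simp: isos_def bij_betw_def)
      moreover have "f ` ?V \<subseteq> {..<n}" "\<forall>e\<in>?T f. w e"
        using H(1) by (auto simp: * subgraph_def host_def)
      ultimately show "f \<in> {f \<in> X. \<Theta> f = H}"
        by (auto simp: X_def embeddings_def \<Theta>_def PiE_def)
    qed (use iso in auto)
    moreover obtain f0 where "f0 \<in> isos G H"
      using isomorphic_imp_isos[OF G _ H(2)] H(1) by (auto simp: subgraph_def)
    ultimately show "card {f \<in> X. \<Theta> f = H} = card (isos G G)"
      using card_isos_eq_card_automorphisms[OF G] by metis
  qed simp
  finally have "real (card X) = card (isos G G) * subgraph_count G (host w)"
    by (simp add: subgraph_count_def C_def)
  moreover have "(\<Sum>f\<in>embeddings G n. all_true (?T f) w) = real (card X)"
    using finite_embeddings[OF fin, of n]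
    by (simp add: all_true_def X_def of_bool_def sum.If_cases Int_def)
  ultimately show ?thesis by simp
qed

section \<open>Subgraph counts\<close>

text \<open>Classify embeddings by a nonempty set \<open>F\<close> of edges sent into
  \<open>\<Gamma>\<close>, with at most \<open>2 ^ num_edges G\<close> choices. The endpoints of
  \<open>F\<close> then have boundedly many possible images and the other vertices at most
  \<open>n\<close> each, while the edges outside \<open>F\<close> supply the powers of
  \<open>p\<close>; the lower bound \<open>m\<close> for \<open>F\<close> makes the estimate uniform
  in \<open>F\<close>.\<close>

lemma sum_attached_embeddings_le:
  fixes p m :: real
  assumes G: "finite_simple_graph G" and r: "num_edges G \<ge> 1"
    and p: "0 < p" and n: "n > 0" and m: "0 < m"
    and m_le: "\<And>F. F \<subseteq> edges G \<Longrightarrow> F \<noteq> {} \<Longrightarrow> m \<le> real n ^ card (\<Union>F) * p ^ card F"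
    and \<Gamma>: "\<Gamma> \<subseteq> complete_edges {..<n}" "card \<Gamma> \<le> 3 * num_edges G"
  shows "(\<Sum>f\<in>embeddings G n. of_bool (edge_image f (edges G) \<inter> \<Gamma> \<noteq> {}) * p ^ card (\<Gamma> \<union> edge_image f (edges G)))
    \<le> 2 ^ num_edges G * (6 * num_edges G) ^ num_verts G *
        (real n ^ num_verts G * p ^ num_edges G / m) * p ^ card \<Gamma>"
proof -
  define V E r v where "V = verts G" and "E = edges G" and "r = num_edges G" and "v = num_verts G"
  have E: "E \<subseteq> complete_edges V" and fin_V: "finite V" and fin_E: "finite E" and card_E: "card E = r"
    and card_V: "card V = v" and r1: "r \<ge> 1"
    using G r finite_subset[OF _ finite_complete_edges, of "edges G" "verts G"]
    by (auto simp: finite_simple_graph_def V_def E_def r_def v_def num_edges_def num_verts_def)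
  have fin_\<Gamma>: "finite \<Gamma>" using \<Gamma>(1) finite_complete_edges[of "{..<n}"] finite_subset by blast
  have fin_emb: "finite (embeddings G n)" by (rule finite_embeddings) (use fin_V V_def in simp)
  define D where "D = Pow E - {{}}"
  have fin_D: "finite D" using fin_E by (simp add: D_def)
  define hit where "hit f F = (of_bool (\<forall>e\<in>F. f ` e \<in> \<Gamma>) :: real)" for f :: "'a \<Rightarrow> nat" and F
  have "(\<Sum>f\<in>embeddings G n. of_bool (edge_image f E \<inter> \<Gamma> \<noteq> {}) * p ^ card (\<Gamma> \<union> edge_image f E))
      \<le> (\<Sum>f\<in>embeddings G n. \<Sum>F\<in>D. hit f F * (p ^ card \<Gamma> * p ^ (r - card F)))"
  proof (rule sum_mono)
    fix f assume f: "f \<in> embeddings G n"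
    then have inj: "inj_on f V" by (simp add: embeddings_def V_def)
    \<comment> \<open>For the exact set of edges sent into \<open>\<Gamma>\<close>, the term on the
      right equals the left side; the other terms are nonnegative.\<close>
    define F where "F = {e \<in> E. f ` e \<in> \<Gamma>}"
    show "of_bool (edge_image f E \<inter> \<Gamma> \<noteq> {}) * p ^ card (\<Gamma> \<union> edge_image f E)
        \<le> (\<Sum>F\<in>D. hit f F * (p ^ card \<Gamma> * p ^ (r - card F)))"
    proof (cases "edge_image f E \<inter> \<Gamma> = {}")
      case True
      then show ?thesis using p by (auto simp: hit_def intro!: sum_nonneg)
    next
      case False
      then have "F \<in> D" by (auto simp: F_def D_def edge_image_def)
      have "edge_image f E - \<Gamma> = edge_image f (E - F)" by (auto simp: edge_image_def F_def)
      then have "\<Gamma> \<union> edge_image f E = \<Gamma> \<union> edge_image f (E - F)" "\<Gamma> \<inter> edge_image f (E - F) = {}" by auto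
      then have "card (\<Gamma> \<union> edge_image f E) = card \<Gamma> + card (edge_image f (E - F))"
        using fin_\<Gamma> fin_E by (simp add: card_Un_disjoint edge_image_def)
      also have "card (edge_image f (E - F)) = card (E - F)"
        by (rule card_edge_image[OF inj]) (use E in auto)
      also have "\<dots> = r - card F"
        using fin_E card_E by (subst card_Diff_subset) (auto simp: F_def)
      finally have "of_bool (edge_image f E \<inter> \<Gamma> \<noteq> {}) * p ^ card (\<Gamma> \<union> edge_image f E)
          = hit f F * (p ^ card \<Gamma> * p ^ (r - card F))"
        using False by (simp add: power_add hit_def F_def)
      also have "\<dots> \<le> (\<Sum>F\<in>D. hit f F * (p ^ card \<Gamma> * p ^ (r - card F)))"
        by (rule member_le_sum[OF \<open>F \<in> D\<close> _ fin_D]) (use p in \<open>auto simp: hit_def\<close>)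
      finally show ?thesis .
    qed
  qed
  also have "\<dots> = (\<Sum>F\<in>D. (\<Sum>f\<in>embeddings G n. hit f F) * (p ^ card \<Gamma> * p ^ (r - card F)))"
    by (subst sum.swap) (simp add: sum_distrib_right)
  also have "\<dots> \<le> (\<Sum>F\<in>D. (6 * r) ^ v * (real n ^ v * p ^ r / m) * p ^ card \<Gamma>)"
  proof (rule sum_mono)
    fix F assume "F \<in> D"
    then have F: "F \<subseteq> E" "F \<noteq> {}" by (auto simp: D_def)
    have UF: "\<Union>F \<subseteq> V" using F E by (auto simp: complete_edges_def)
    have fin_F: "finite F" using F(1) fin_E by (rule finite_subset)
    have card_F: "card F \<le> r" using card_mono[OF fin_E F(1)] card_E by simp
    have card_UF: "card (\<Union>F) \<le> v" using card_mono[OF fin_V UF] card_V by simp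
    \<comment> \<open>At most \<open>3 * r\<close> edges with two endpoints each.\<close>
    have card_U\<Gamma>: "card (\<Union>\<Gamma>) \<le> 6 * r"
    proof -
      have "card (\<Union>\<Gamma>) \<le> (\<Sum>e\<in>\<Gamma>. card e)"
        by (rule card_Union_le_sum_card)
      also have "\<dots> = (\<Sum>e\<in>\<Gamma>. 2)"
        using \<Gamma>(1) by (intro sum.cong) (auto simp: complete_edges_def)
      finally show ?thesis using \<Gamma>(2) by (simp add: r_def)
    qed
    have fin_U\<Gamma>: "finite (\<Union>\<Gamma>)"
      by (rule finite_subset[of _ "{..<n}"]) (use \<Gamma>(1) in \<open>auto simp: complete_edges_def\<close>)
    \<comment> \<open>A box containing all embeddings that send \<open>F\<close> into
      \<open>\<Gamma>\<close>: endpoints of \<open>F\<close> land on vertices of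
      \<open>\<Gamma>\<close>, the remaining vertices anywhere.\<close>
    define B where "B x = (if x \<in> \<Union>F then \<Union>\<Gamma> else {..<n})" for x
    have "(\<Sum>f\<in>embeddings G n. hit f F) = card {f \<in> embeddings G n. \<forall>e\<in>F. f ` e \<in> \<Gamma>}"
      using fin_emb by (simp add: hit_def of_bool_def sum.If_cases Int_def)
    also have "\<dots> \<le> card (PiE V B)"
    proof (intro of_nat_mono card_mono)
      show "finite (PiE V B)" using fin_V fin_U\<Gamma> by (intro finite_PiE) (auto simp: B_def)
      show "{f \<in> embeddings G n. \<forall>e\<in>F. f ` e \<in> \<Gamma>} \<subseteq> PiE V B"
      proof (intro subsetI PiE_I)
        fix f x assume f: "f \<in> {f \<in> embeddings G n. \<forall>e\<in>F. f ` e \<in> \<Gamma>}"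
        show "f x \<in> B x" if "x \<in> V"
        proof (cases "x \<in> \<Union>F")
          case True
          then obtain e where "e \<in> F" "x \<in> e" by blast
          then have "f ` e \<in> \<Gamma>" "f x \<in> f ` e" using f by auto
          then show ?thesis using True by (auto simp: B_def)
        next
          case False
          then show ?thesis using f that by (auto simp: embeddings_def V_def B_def)
        qed
        show "f x = undefined" if "x \<notin> V"
          using f that by (auto simp: embeddings_def V_def PiE_def extensional_def)
      qed
    qed
    also have "card (PiE V B) = (\<Prod>x\<in>V. card (B x))" by (rule card_PiE[OF fin_V])
    also have "\<dots> = (\<Prod>x\<in>\<Union>F. card (B x)) * (\<Prod>x\<in>V - \<Union>F. card (B x))"
      using prod.subset_diff[OF UF fin_V] by (simp only: mult.commute)
    also have "\<dots> = card (\<Union>\<Gamma>) ^ card (\<Union>F) * n ^ card (V - \<Union>F)"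
      by (simp add: B_def)
    also have "card (V - \<Union>F) = v - card (\<Union>F)"
      using card_Diff_subset[OF finite_subset[OF UF fin_V] UF] card_V by simp
    also have "real (card (\<Union>\<Gamma>) ^ card (\<Union>F) * n ^ (v - card (\<Union>F))) \<le> (6 * r) ^ v * n ^ (v - card (\<Union>F))"
    proof -
      have "card (\<Union>\<Gamma>) ^ card (\<Union>F) \<le> (6 * r) ^ card (\<Union>F)"
        using card_U\<Gamma> by (rule power_mono) simp
      also have "\<dots> \<le> (6 * r) ^ v" using card_UF r1 by (intro power_increasing) auto
      finally show ?thesis by (simp flip: of_nat_mult of_nat_power)
    qed
    finally have "(\<Sum>f\<in>embeddings G n. hit f F) * (p ^ card \<Gamma> * p ^ (r - card F))
        \<le> real ((6 * r) ^ v * n ^ (v - card (\<Union>F))) * (p ^ card \<Gamma> * p ^ (r - card F))"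
      using p by (intro mult_right_mono) auto
    also have "\<dots> = (6 * r) ^ v * (real n ^ (v - card (\<Union>F)) * p ^ (r - card F)) * p ^ card \<Gamma>"
      by simp
    also have "\<dots> \<le> (6 * r) ^ v * (real n ^ v * p ^ r / m) * p ^ card \<Gamma>"
    proof (intro mult_left_mono mult_right_mono)
      \<comment> \<open>Multiplying by \<open>m\<close> and using its bound for the subgraph spanned
        by \<open>F\<close> restores exactly the missing powers of \<open>n\<close> and
        \<open>p\<close>.\<close>
      have "real n ^ (v - card (\<Union>F)) * p ^ (r - card F) * m
          \<le> real n ^ (v - card (\<Union>F)) * p ^ (r - card F) * (real n ^ card (\<Union>F) * p ^ card F)"
        using m_le[of F] F p by (intro mult_left_mono) (auto simp: E_def)
      also have "\<dots> = (real n ^ (v - card (\<Union>F)) * real n ^ card (\<Union>F)) * (p ^ (r - card F) * p ^ card F)"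
        by (simp add: mult_ac)
      also have "\<dots> = real n ^ v * p ^ r"
        using card_F card_UF by (simp flip: power_add)
      finally show "real n ^ (v - card (\<Union>F)) * p ^ (r - card F) \<le> real n ^ v * p ^ r / m"
        using m by (simp add: field_simps)
    qed (use p in auto)
    finally show "(\<Sum>f\<in>embeddings G n. hit f F) * (p ^ card \<Gamma> * p ^ (r - card F))
        \<le> (6 * r) ^ v * (real n ^ v * p ^ r / m) * p ^ card \<Gamma>" .
  qed
  also have "\<dots> = card D * ((6 * r) ^ v * (real n ^ v * p ^ r / m) * p ^ card \<Gamma>)"
    by simp
  also have "\<dots> \<le> 2 ^ r * ((6 * r) ^ v * (real n ^ v * p ^ r / m) * p ^ card \<Gamma>)"
  proof (rule mult_right_mono)
    have "card D \<le> card (Pow E)" unfolding D_def using fin_E by (intro card_mono) auto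
    then have "card D \<le> 2 ^ r" using fin_E card_E by (simp add: card_Pow)
    then show "real (card D) \<le> 2 ^ r" by (simp flip: of_nat_power)
  qed (use p m in auto)
  finally show ?thesis by (simp add: E_def r_def v_def mult.assoc)
qed

section \<open>Lower bound for the variance\<close>

text \<open>The number is a falling factorial. With \<open>v = num_verts G\<close>, each factor is
  at least \<open>n - (v - 1)\<close>, and this is at least \<open>n / v\<close> because
  \<open>(v - 1) * v \<le> (v - 1) * n\<close>.\<close>

lemma card_embeddings_ge:
  assumes "finite (verts G)" and v: "num_verts G \<ge> 1" and n: "n \<ge> num_verts G"
  shows "(n / num_verts G) ^ num_verts G \<le> card (embeddings G n)"
proof -
  define v where "v = num_verts G"
  have "card (embeddings G n) = prod ((-) n) {0..<v}"
    using card_inj_on_subset_funcset[of "verts G" "{..<n}" "verts G"] assms(1)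
    by (simp add: embeddings_def v_def num_verts_def)
  then have "real (card (embeddings G n)) = (\<Prod>i = 0..<v. real (n - i))" by simp
  moreover have "(\<Prod>i = 0..<v. real n / v) \<le> (\<Prod>i = 0..<v. real (n - i))"
  proof (rule prod_mono)
    fix i assume i: "i \<in> {0..<v}"
    have "(v - 1) * v \<le> (v - 1) * n" using n by (intro mult_left_mono) (auto simp: v_def)
    then have "real (v - 1) * v \<le> real (v - 1) * n" by (simp flip: of_nat_mult)
    then have "real n \<le> real v * (real n - real (v - 1))"
      using v by (simp add: v_def[symmetric] of_nat_diff algebra_simps)
    also have "\<dots> \<le> real v * real (n - i)"
      using i n by (intro mult_left_mono) (auto simp: v_def[symmetric] of_nat_diff)
    finally show "0 \<le> real n / v \<and> real n / v \<le> real (n - i)"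
      using v by (simp add: v_def[symmetric] field_simps)
  qed
  ultimately show ?thesis by (simp add: v_def)
qed

text \<open>Keep only pairs of embeddings agreeing on the vertices of \<open>H\<close>. There are at
  least the squared number of embeddings divided by \<open>n ^ num_verts H\<close> of them, and each
  pair shares the image of \<open>edges H\<close>, which keeps its covariance large.\<close>

lemma variance_embeddings_ge:
  fixes p :: real
  assumes G: "finite_simple_graph G" and v: "num_verts G \<ge> 1" and n: "n \<ge> num_verts G"
    and p: "0 < p" "p < 1" and H: "subgraph H G" "num_edges H \<ge> 1"
  defines "T \<equiv> \<lambda>f. edge_image f (edges G)"
  shows "(1 - p) * (real n ^ num_verts G * p ^ num_edges G)\<^sup>2
      / (real (num_verts G) ^ (2 * num_verts G) * (real n ^ num_verts H * p ^ num_edges H))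
    \<le> (\<Sum>f\<in>embeddings G n. \<Sum>g\<in>embeddings G n. p ^ card (T f \<union> T g) - p ^ (card (T f) + card (T g)))"
proof -
  define X where "X = embeddings G n"
  define V E r v h b where "V = verts G" and "E = edges G" and "r = num_edges G" and "v = num_verts G"
    and "h = num_verts H" and "b = num_edges H"
  have E: "E \<subseteq> complete_edges V" and fin_V: "finite V" and fin_E: "finite E" and card_E: "card E = r"
    using G finite_subset[OF _ finite_complete_edges, of "edges G" "verts G"]
    by (auto simp: finite_simple_graph_def V_def E_def r_def num_edges_def)
  have HV: "verts H \<subseteq> V" and HE: "edges H \<subseteq> E" "edges H \<subseteq> complete_edges (verts H)" and fin_HV: "finite (verts H)"
    using H(1) by (auto simp: subgraph_def V_def E_def finite_simple_graph_def)
  have n0: "real n > 0" using n assms(2) by simp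
  have v0: "real v > 0" using assms(2) by (simp add: v_def)
  have fin_X: "finite X" unfolding X_def by (rule finite_embeddings) (use fin_V V_def in simp)
  have card_T: "card (T f) = r" if "f \<in> X" for f
    using that card_edge_image[OF _ E, of f] card_E by (simp add: T_def X_def embeddings_def V_def E_def)
  have fin_T: "finite (T f)" for f using fin_E by (simp add: T_def E_def edge_image_def)
  have br: "b \<le> r" using card_mono[OF fin_E HE(1)] card_E by (simp add: b_def num_edges_def)
  define \<rho> where "\<rho> f = restrict f (verts H)" for f :: "'a \<Rightarrow> nat"
  define P where "P = {(f, g) \<in> X \<times> X. \<rho> f = \<rho> g}"
  have fin_P: "finite P" by (rule finite_subset[of _ "X \<times> X"]) (auto simp: P_def fin_X)
  \<comment> \<open>All covariances are nonnegative, so discarding pairs only lowers the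
    sum.\<close>
  have nonneg: "0 \<le> p ^ card (T f \<union> T g) - p ^ (card (T f) + card (T g))" for f g
    using p card_Un_le[of "T f" "T g"] by (auto intro!: power_decreasing)
  have "(real (card X))\<^sup>2 \<le> real (card (verts H \<rightarrow>\<^sub>E {..<n})) * real (card P)"
    unfolding P_def
    by (rule card_squared_le_card_fibre_pairs[OF fin_X])
      (use HV fin_HV in \<open>auto simp: \<rho>_def X_def embeddings_def V_def finite_PiE PiE_iff\<close>)
  then have "(real (card X))\<^sup>2 \<le> real n ^ h * real (card P)"
    using fin_HV by (simp add: card_funcsetE h_def num_verts_def)
  moreover have "((real n / v) ^ v)\<^sup>2 \<le> (real (card X))\<^sup>2"
    using card_embeddings_ge[of G n] fin_V assms(2) n
    by (intro power_mono) (auto simp: X_def v_def V_def)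
  ultimately have "((real n / v) ^ v)\<^sup>2 \<le> real (card P) * real n ^ h"
    by (simp only: mult.commute)
  then have P: "((real n / v) ^ v)\<^sup>2 / real n ^ h \<le> real (card P)"
    by (subst pos_divide_le_eq) (use n0 in auto)
  have "(1 - p) * (real n ^ v * p ^ r)\<^sup>2 / (real v ^ (2 * v) * (real n ^ h * p ^ b))
      = ((real n / v) ^ v)\<^sup>2 / real n ^ h * ((1 - p) * (p ^ r)\<^sup>2 / p ^ b)"
    by (simp add: power_divide power_mult power_mult_distrib power2_eq_square power_add mult_2 mult_ac)
  also have "\<dots> \<le> real (card P) * ((1 - p) * (p ^ r)\<^sup>2 / p ^ b)"
    using P p by (intro mult_right_mono) auto
  also have "\<dots> = (\<Sum>(f, g)\<in>P. (1 - p) * (p ^ r)\<^sup>2 / p ^ b)"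
    by simp
  also have "\<dots> \<le> (\<Sum>(f, g)\<in>P. p ^ card (T f \<union> T g) - p ^ (card (T f) + card (T g)))"
  proof (rule sum_mono, clarify)
    fix f g assume "(f, g) \<in> P"
    then have fg: "f \<in> X" "g \<in> X" "\<And>x. x \<in> verts H \<Longrightarrow> f x = g x"
      by (auto simp: P_def \<rho>_def restrict_def fun_eq_iff split: if_splits)
    have inj: "inj_on f V" using fg(1) by (simp add: X_def embeddings_def V_def)
    have "edge_image f (edges H) = edge_image g (edges H)"
      by (rule edge_image_cong[OF HE(2) fg(3)])
    moreover have "edge_image k (edges H) \<subseteq> T k" for k
      using HE(1) by (auto simp: T_def E_def edge_image_def)
    ultimately have "edge_image f (edges H) \<subseteq> T f \<inter> T g"
      by (metis le_inf_iff)
    then have "card (edge_image f (edges H)) \<le> card (T f \<inter> T g)"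
      by (intro card_mono) (auto simp: fin_T)
    moreover have "card (edge_image f (edges H)) = b"
      unfolding b_def num_edges_def by (rule card_edge_image[OF inj]) (use HE(1) E in auto)
    moreover have "card (T f \<union> T g) + card (T f \<inter> T g) = r + r"
      using card_Un_Int[OF fin_T fin_T, of f g] card_T fg by simp
    ultimately have "card (T f \<union> T g) \<le> 2 * r - b" by linarith
    then have "p ^ (2 * r - b) \<le> p ^ card (T f \<union> T g)"
      using p by (intro power_decreasing) auto
    moreover have "(1 - p) * (p ^ r)\<^sup>2 / p ^ b \<le> p ^ (2 * r - b) - p ^ (r + r)"
    proof -
      have eq: "p ^ (r + r) = p ^ (2 * r - b) * p ^ b"
        using br by (simp add: mult_2 flip: power_add)
      \<comment> \<open>Since \<open>b \<ge> 1\<close>, the factor \<open>1 - p ^ b\<close> is at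
        least \<open>1 - p\<close>, which keeps the bound sharp as \<open>p\<close> tends to
        1.\<close>
      have "p ^ b \<le> p ^ 1" using p H(2) by (intro power_decreasing) (auto simp: b_def)
      then have "p ^ (2 * r - b) * (1 - p) \<le> p ^ (2 * r - b) * (1 - p ^ b)"
        using p by (intro mult_left_mono) auto
      moreover have "(p ^ r)\<^sup>2 / p ^ b = p ^ (2 * r - b)"
        using eq p by (simp add: power2_eq_square power_add)
      moreover have "(1 - p) * (p ^ r)\<^sup>2 / p ^ b = (1 - p) * ((p ^ r)\<^sup>2 / p ^ b)" by simp
      ultimately show ?thesis unfolding eq by (simp only: algebra_simps mult_1_right)
    qed
    ultimately show "(1 - p) * (p ^ r)\<^sup>2 / p ^ b \<le> p ^ card (T f \<union> T g) - p ^ (card (T f) + card (T g))"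
      using card_T fg by simp
  qed
  also have "\<dots> \<le> (\<Sum>(f, g)\<in>X \<times> X. p ^ card (T f \<union> T g) - p ^ (card (T f) + card (T g)))"
    by (rule sum_mono2) (use fin_X nonneg in \<open>auto simp: P_def\<close>)
  also have "\<dots> = (\<Sum>f\<in>X. \<Sum>g\<in>X. p ^ card (T f \<union> T g) - p ^ (card (T f) + card (T g)))"
    by (simp add: sum.cartesian_product)
  finally show ?thesis by (simp add: X_def v_def r_def h_def b_def)
qed

section \<open>Normal approximation of subgraph counts\<close>

theorem theorem4p2:
  fixes G :: "'a ugraph"
  assumes "finite_simple_graph G"
    and "\<And>v. \<not> isolated_vertex G v"
    and "num_edges G \<ge> 1"
  shows "\<exists>C::real. C > 0 \<and>
    (\<forall>(p::real) (n::nat). 0 < p \<longrightarrow> p < 1 \<longrightarrow> n \<ge> num_verts G \<longrightarrow>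
      kolmogorov_dist
        (distr (measure_pmf (random_graph n p)) borel (normalized_subgraph_count G n p))
        std_normal_distribution
      \<le> C * ((1 - p) *
          (MIN H\<in>{H. subgraph H G \<and> num_edges H \<ge> 1}.
             real n ^ num_verts H * p ^ num_edges H)) powr (- 1 / 2))"
proof -
  note G = assms(1)
  define v r where "v = num_verts G" and "r = num_edges G"
  have E: "edges G \<subseteq> complete_edges (verts G)" and fin_V: "finite (verts G)"
    using G by (auto simp: finite_simple_graph_def)
  have fin_E: "finite (edges G)" using E finite_complete_edges[OF fin_V] by (rule finite_subset)
  have r1: "r \<ge> 1" using assms(3) by (simp add: r_def)
  have v1: "v \<ge> 1"
  proof -
    have "edges G \<noteq> {}" using assms(3) by (auto simp: num_edges_def)
    then have "verts G \<noteq> {}" using E by (fastforce simp: complete_edges_def)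
    then show ?thesis using fin_V by (simp add: v_def num_verts_def card_gt_0_iff Suc_leI)
  qed
  \<comment> \<open>\<open>C0\<close> is the combinatorial factor of the attachment estimate.
    \<open>C\<close> combines the 4 of the Kolmogorov bound, the overlap constant under the root,
    and \<open>v ^ (2 * v)\<close> from the lower bound on the variance; none depends on
    \<open>n\<close> or \<open>p\<close>.\<close>
  define C0 :: real where "C0 = 2 ^ r * (6 * r) ^ v"
  define C :: real where "C = 4 * sqrt (2 * (real r)\<^sup>2 * C0 ^ 3) * real v ^ (2 * v)"
  have C0: "C0 > 0" using r1 by (simp add: C0_def)
  have C: "C > 0" using C0 r1 v1 by (simp add: C_def)
  have "kolmogorov_dist
        (distr (measure_pmf (random_graph n p)) borel (normalized_subgraph_count G n p))
        std_normal_distribution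
      \<le> C * ((1 - p) *
          (MIN H\<in>{H. subgraph H G \<and> num_edges H \<ge> 1}.
             real n ^ num_verts H * p ^ num_edges H)) powr (- 1 / 2)"
    if p: "0 < p" "p < 1" and n: "n \<ge> num_verts G" for p :: real and n :: nat
  proof -
    interpret bernoulli_product "complete_edges {..<n}" p
      using p by unfold_locales (auto simp: finite_complete_edges)
    define host where "host w = ({..<n}, {e \<in> complete_edges {..<n}. w e})" for w
    define T where "T f = edge_image f (edges G)" for f :: "'a \<Rightarrow> nat"
    define I where "I = embeddings G n"
    define N where "N = (\<lambda>w. \<Sum>f\<in>I. all_true (T f) w)"
    define a where "a = real (card (isos G G))"
    define var where "var = measure_pmf.variance M N"
    define X where "X = real n ^ v * p ^ r"
    define \<H> where "\<H> = {H. subgraph H G \<and> num_edges H \<ge> 1}"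
    define m where "m = (MIN H\<in>\<H>. real n ^ num_verts H * p ^ num_edges H)"
    have n0: "n > 0" using n v1 by (simp add: v_def)
    have X: "X > 0" using n0 p by (simp add: X_def)
    have fin_I: "finite I" unfolding I_def by (rule finite_embeddings[OF fin_V])
    have T: "T f \<subseteq> complete_edges {..<n}" if "f \<in> I" for f
      unfolding T_def using that E by (intro edge_image_complete_edges[where V = "verts G"]) (auto simp: I_def embeddings_def)
    have card_T: "card (T f) = r" if "f \<in> I" for f
      using that card_edge_image[OF _ E, of f] by (simp add: T_def I_def embeddings_def r_def num_edges_def)

    have "finite \<H>"
    proof (rule finite_subset)
      show "\<H> \<subseteq> Pow (verts G) \<times> Pow (edges G)" by (auto simp: \<H>_def subgraph_def)
      show "finite (Pow (verts G) \<times> Pow (edges G))" using fin_V fin_E by simp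
    qed
    moreover have "G \<in> \<H>" using G assms(3) by (simp add: \<H>_def subgraph_def)
    ultimately have m_le: "H \<in> \<H> \<Longrightarrow> m \<le> real n ^ num_verts H * p ^ num_edges H"
      and m_in: "m \<in> (\<lambda>H. real n ^ num_verts H * p ^ num_edges H) ` \<H>" for H
      unfolding m_def by (blast intro: Min_le Min_in)+
    from m_in obtain H where H: "subgraph H G" "num_edges H \<ge> 1" "m = real n ^ num_verts H * p ^ num_edges H"
      by (auto simp: \<H>_def)
    have m: "m > 0" using H(3) n0 p by simp
    \<comment> \<open>A nonempty edge set together with its endpoints is one of the subgraphs over
      which the minimum is taken.\<close>
    have m_le_edges: "m \<le> real n ^ card (\<Union>F) * p ^ card F" if F: "F \<subseteq> edges G" "F \<noteq> {}" for F
    proof -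
      have "subgraph (\<Union>F, F) G"
        using F E fin_V by (auto simp: subgraph_def finite_simple_graph_def complete_edges_def
            intro: finite_subset[of _ "verts G"])
      moreover have "card F \<ge> 1" using F finite_subset[OF F(1) fin_E] by (simp add: card_gt_0_iff Suc_leI)
      ultimately show ?thesis using m_le[of "(\<Union>F, F)"] by (simp add: \<H>_def num_verts_def num_edges_def)
    qed

    \<comment> \<open>The variance estimate is applied to a minimising \<open>H\<close>, so that
      \<open>m\<close> itself appears in the denominator.\<close>
    have "var = (\<Sum>f\<in>I. \<Sum>g\<in>I. p ^ card (T f \<union> T g) - p ^ (card (T f) + card (T g)))"
      unfolding var_def N_def by (rule variance_count[OF fin_I T])
    then have "(1 - p) * X\<^sup>2 / (real v ^ (2 * v) * m) \<le> var"
      using variance_embeddings_ge[OF G _ n p H(1,2)] v1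
      by (simp add: X_def v_def r_def H(3) I_def T_def)
    moreover have pos: "(1 - p) * X\<^sup>2 / (real v ^ (2 * v) * m) > 0"
      using X m p v1 by simp
    ultimately have var_ge: "(1 - p) * X\<^sup>2 / (real v ^ (2 * v) * m) \<le> var" and var: "var > 0" by auto

    define S where "S = overlap_sum p (SIGMA k:complete_edges {..<n}. {i \<in> I. k \<in> T i} \<times> {j \<in> I. k \<in> T j})
      (\<lambda>(k, i, j). T i \<union> T j)"
    have "S \<le> 2 * (real r)\<^sup>2 * (C0 * (X / m)) ^ 3 * card I * p ^ r"
      unfolding S_def
    proof (rule overlap_sum_le_of_attachment[OF _ fin_I T card_T])
      fix \<Gamma> assume \<Gamma>: "\<Gamma> \<subseteq> complete_edges {..<n}" "card \<Gamma> \<le> 3 * r"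
      have "(\<Sum>f\<in>embeddings G n. of_bool (edge_image f (edges G) \<inter> \<Gamma> \<noteq> {}) * p ^ card (\<Gamma> \<union> edge_image f (edges G)))
        \<le> 2 ^ num_edges G * (6 * num_edges G) ^ num_verts G *
            (real n ^ num_verts G * p ^ num_edges G / m) * p ^ card \<Gamma>"
      proof (rule sum_attached_embeddings_le[OF G assms(3) p(1) n0 m])
        show "m \<le> real n ^ card (\<Union>F) * p ^ card F" if "F \<subseteq> edges G" "F \<noteq> {}" for F
          by (rule m_le_edges[OF that])
      qed (use \<Gamma> in \<open>simp_all add: r_def\<close>)
      then show "(\<Sum>i\<in>I. of_bool (T i \<inter> \<Gamma> \<noteq> {}) * p ^ card (\<Gamma> \<union> T i)) \<le> C0 * (X / m) * p ^ card \<Gamma>"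
        by (simp add: I_def T_def C0_def X_def v_def r_def)
    qed (use p C0 X m in \<open>auto simp: finite_complete_edges\<close>)
    \<comment> \<open>Bounding the number of embeddings by \<open>n ^ v\<close> turns the leftover
      factor into a fourth \<open>X\<close>.\<close>
    also have "\<dots> \<le> 2 * (real r)\<^sup>2 * (C0 * (X / m)) ^ 3 * n ^ v * p ^ r"
    proof (intro mult_right_mono mult_left_mono)
      have "card I \<le> card (verts G \<rightarrow>\<^sub>E {..<n})"
        unfolding I_def embeddings_def using fin_V by (intro card_mono finite_PiE) auto
      then show "real (card I) \<le> real (n ^ v)" using fin_V by (simp add: card_funcsetE v_def num_verts_def)
    qed (use p C0 X m in auto)
    also have "\<dots> = 2 * (real r)\<^sup>2 * C0 ^ 3 * (X ^ 4 / m ^ 3)"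
      by (simp add: X_def power_mult_distrib power_divide eval_nat_numeral)
    finally have S: "S \<le> 2 * (real r)\<^sup>2 * C0 ^ 3 * (X ^ 4 / m ^ 3)" .

    have "4 * sqrt ((1 - p) * S) / var
        \<le> 4 * sqrt ((1 - p) * (2 * (real r)\<^sup>2 * C0 ^ 3 * (X ^ 4 / m ^ 3)))
            / ((1 - p) * X\<^sup>2 / (real v ^ (2 * v) * m))"
    proof (rule frac_le)
      show "4 * sqrt ((1 - p) * S) \<le> 4 * sqrt ((1 - p) * (2 * (real r)\<^sup>2 * C0 ^ 3 * (X ^ 4 / m ^ 3)))"
        using S p by (intro mult_left_mono real_sqrt_le_mono) auto
    qed (use var_ge pos p C0 X m in auto)
    also have "\<dots> = C * (sqrt ((1 - p) * (X ^ 4 / m ^ 3)) * m / ((1 - p) * X\<^sup>2))"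
    proof -
      have "sqrt ((1 - p) * (2 * (real r)\<^sup>2 * C0 ^ 3 * (X ^ 4 / m ^ 3)))
          = sqrt (2 * (real r)\<^sup>2 * C0 ^ 3) * sqrt ((1 - p) * (X ^ 4 / m ^ 3))"
        unfolding real_sqrt_mult[symmetric] by (simp only: mult_ac)
      then show ?thesis by (simp add: C_def)
    qed
    \<comment> \<open>All powers of \<open>X\<close> cancel, and \<open>q = 1 - p\<close> and
      \<open>m\<close> are left with the exponent minus one half each.\<close>
    also have "sqrt ((1 - p) * (X ^ 4 / m ^ 3)) * m / ((1 - p) * X\<^sup>2) = 1 / sqrt ((1 - p) * m)"
    proof -
      define q where "q = 1 - p"
      have q: "q > 0" using p by (simp add: q_def)
      have "q * (X ^ 4 / m ^ 3) = (q * X\<^sup>2 / m)\<^sup>2 / (q * m)"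
        using q m by (simp add: field_simps eval_nat_numeral)
      then have "sqrt (q * (X ^ 4 / m ^ 3)) = (q * X\<^sup>2 / m) / sqrt (q * m)"
        using q m X by (simp add: real_sqrt_divide)
      then show ?thesis using q m X by (simp flip: q_def)
    qed
    also have "\<dots> = ((1 - p) * m) powr (- 1 / 2)"
      using p m by (simp add: powr_minus_divide powr_half_sqrt flip: minus_divide_left)
    finally have bound: "4 * sqrt ((1 - p) * S) / var \<le> C * ((1 - p) * m) powr (- 1 / 2)" .

    have a: "a > 0" using card_automorphisms_pos[OF G] by (simp add: a_def)
    have count: "subgraph_count G (host w) = N w / a" for w
      using card_automorphisms_mult_subgraph_count[OF G, of n w] a
      by (simp add: host_def N_def I_def T_def a_def field_simps)
    have rg: "random_graph n p = map_pmf host M"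
      by (simp add: random_graph_def host_def[abs_def])
    \<comment> \<open>The number of automorphisms scales the count, its mean and its standard
      deviation alike, so normalisation removes it.\<close>
    have "normalized_subgraph_count G n p (host w) = (N w - expect N) / sqrt var" for w
    proof -
      have "expect (\<lambda>w. (N w / a - expect N / a)\<^sup>2) = var / a\<^sup>2"
        unfolding var_def by (simp add: power_divide flip: diff_divide_distrib)
      moreover have "(N w / a - expect N / a) / sqrt (var / a\<^sup>2) = (N w - expect N) / sqrt var"
        using a by (simp add: real_sqrt_divide flip: diff_divide_distrib)
      ultimately show ?thesis by (simp add: normalized_subgraph_count_def rg count)
    qed
    then have "cdf (distr (measure_pmf (random_graph n p)) borel (normalized_subgraph_count G n p)) x
        = measure_pmf.prob M {w. (N w - expect N) / sqrt var \<le> x}" for x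
      by (simp add: cdf_def measure_distr rg vimage_def)
    then have "\<bar>cdf (distr (measure_pmf (random_graph n p)) borel (normalized_subgraph_count G n p)) x - \<Phi> x\<bar>
        \<le> 4 * sqrt ((1 - p) * S) / var" for x
      using count_kolmogorov_bound[OF fin_I T, where z = x] var
      by (simp add: var_def N_def S_def)
    \<comment> \<open>The pointwise bound does not depend on \<open>x\<close>, so it passes to the
      supremum.\<close>
    then have "kolmogorov_dist
        (distr (measure_pmf (random_graph n p)) borel (normalized_subgraph_count G n p))
        std_normal_distribution \<le> 4 * sqrt ((1 - p) * S) / var"
      unfolding kolmogorov_dist_def by (intro cSUP_least) auto
    with bound show ?thesis by (simp add: m_def \<H>_def)
  qed
  with C show ?thesis by blast
qed

end
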